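(* Let $H$ be a group acting freely on a nonempty set $X$, and fix a base point $b_1\in X$. Let $\mathcal{M}(X)$ be the set of all median operations $m:X^3\to X$ compatible with the action of $H$, i.e. $m(hx,hy,hz)=h\,m(x,y,z)$ for all $h\in H$, $x,y,z\in X$, and let $\mathcal{M}_l(X)$ (resp. $\mathcal{M}_s(X)$) be the subset of $\mathcal{M}(X)$ consisting of those median operations which are locally linear (resp. simplicial). Then there exists a group $\widehat{H}$ containing $H$ as a subgroup, together with an injective map $\iota:X\to\widehat{H}$ and a retract $\varphi:\widehat{H}\to X$ of $\iota$ (i.e. $\varphi\circ\iota=\mathrm{id}_X$) such that the following hold. (1) The maps $\iota$ and $\varphi$ are $H$-equivariant, i.e. $\iota(h\cdot x)=h\,\iota(x)$ and $\varphi(hu)=h\cdot\varphi(u)$ for all $h\in H$, $x\in X$, $u\in\widehat{H}$. (2) $\iota(b_1)=1$, so $\iota(Hb_1)=H$, and $\iota(X)$ generates the group $\widehat{H}$. (3) Every $m\in\mathcal{M}(X)$ extends uniquely to a ternary operation $\widehat{m}:\widehat{H}^3\to\widehat{H}$ (extension meaning $\widehat{m}(\iota(x),\iota(y),\iota(z))=\iota(m(x,y,z))$ for all $x,y,z\in X$) such that $(\widehat{H},\widehat{m})$ is a median group and the map $\iota\circ\varphi:\widehat{H}\to\widehat{H}$ is a folding identifying $X$ with a retractible convex subset of the median set $(\widehat{H},\widehat{m})$. (4) The median group $(\widehat{H},\widehat{m})$ is locally linear (resp. simplicial) provided $m\in\mathcal{M}_l(X)$ (resp. $m\in\mathcal{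M}_s(X)$).
   Context: A median operation on a set $X$ is a map $m:X^3\to X$ such that (M1) $m(x,y,z)=m(y,x,z)=m(x,z,y)$; (M2) $m(x,y,x)=x$; (M3) $m(m(x,y,z),u,v)=m(m(x,u,v),m(y,u,v),z)$. The pair $(X,m)$ is then a median set. For $x,y\in X$ put $[x,y]:=\{z\in X : m(x,y,z)=z\}$ (a cell). A subset $M\subseteq X$ is convex if $[x,y]\subseteq M$ for all $x,y\in M$. A nonempty convex subset $M$ is retractible if for every $x\in X$ there is a (necessarily unique) $\psi(x)\in M$ with $[x,a]\cap M=[\psi(x),a]$ for all $a\in M$; the map $\psi:X\to X$ is the folding associated to $M$. Generally a folding of $(X,m)$ is a map $\varphi:X\to X$ with $\varphi(m(x,y,z))=m(\varphi(x),y,\varphi(z))$ for all $x,y,z$; foldings correspond bijectively to retractible convex subsets via $\varphi\mapsto\varphi(X)$. The median set $(X,m)$ (or the operation $m$) is locally linear if $[x,y]=[x,z]\cup[z,y]$ for all $x,y\in X$, $z\in[x,y]$; it is simplicial if every $[x,y]$ is finite. A median group is a group $G$ with a median operation $m:G^3\to G$ satisfying $u\,m(x,y,z)=m(ux,uy,uz)$ for all $u,x,y,z\in G$; it is locally linear (simplicial) if its underlying median set is so. An action of $H$ on $X$ is free if $h\cdot x=x$ for some $x\in X$ implies $h=1$. *)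

theory Defs
  imports "HOL-Algebra.Group_Action" "HOL-Algebra.Generated_Groups"
begin

text \<open>
  Operations on a carrier set \<open>X\<close> are extensional functions (equal to \<open>undefined\<close>
  outside \<open>X \<times> X \<times> X\<close>), so that maps \<open>X \<times> X \<times> X \<rightarrow> X\<close> correspond to exactly one
  HOL function each and unique existence can be expressed by \<open>\<exists>!\<close>.
\<close>

definition median_op :: "'a set \<Rightarrow> ('a \<times> 'a \<times> 'a \<Rightarrow> 'a) \<Rightarrow> bool" where
  "median_op X m \<longleftrightarrow>
     m \<in> X \<times> X \<times> X \<rightarrow>\<^sub>E X \<and>
     (\<forall>x\<in>X. \<forall>y\<in>X. \<forall>z\<in>X. m (x, y, z) = m (y, x, z) \<and> m (x, y, z) = m (x, z, y)) \<and>
     (\<forall>x\<in>X. \<forall>y\<in>X. m (x, y, x) = x) \<and>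
     (\<forall>x\<in>X. \<forall>y\<in>X. \<forall>z\<in>X. \<forall>u\<in>X. \<forall>v\<in>X.
        m (m (x, y, z), u, v) = m (m (x, u, v), m (y, u, v), z))"

definition cell :: "'a set \<Rightarrow> ('a \<times> 'a \<times> 'a \<Rightarrow> 'a) \<Rightarrow> 'a \<Rightarrow> 'a \<Rightarrow> 'a set" where
  "cell X m x y = {z \<in> X. m (x, y, z) = z}"

definition median_convex :: "'a set \<Rightarrow> ('a \<times> 'a \<times> 'a \<Rightarrow> 'a) \<Rightarrow> 'a set \<Rightarrow> bool" where
  "median_convex X m M \<longleftrightarrow> M \<subseteq> X \<and> (\<forall>x\<in>M. \<forall>y\<in>M. cell X m x y \<subseteq> M)"

definition retractible :: "'a set \<Rightarrow> ('a \<times> 'a \<times> 'a \<Rightarrow> 'a) \<Rightarrow> 'a set \<Rightarrow> bool" where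
  "retractible X m M \<longleftrightarrow>
     M \<noteq> {} \<and> median_convex X m M \<and>
     (\<forall>x\<in>X. \<exists>p\<in>M. \<forall>a\<in>M. cell X m x a \<inter> M = cell X m p a)"

definition associated_folding ::
  "'a set \<Rightarrow> ('a \<times> 'a \<times> 'a \<Rightarrow> 'a) \<Rightarrow> 'a set \<Rightarrow> ('a \<Rightarrow> 'a) \<Rightarrow> bool" where
  "associated_folding X m M \<psi> \<longleftrightarrow>
     (\<forall>x\<in>X. \<psi> x \<in> M \<and> (\<forall>a\<in>M. cell X m x a \<inter> M = cell X m (\<psi> x) a))"

definition folding :: "'a set \<Rightarrow> ('a \<times> 'a \<times> 'a \<Rightarrow> 'a) \<Rightarrow> ('a \<Rightarrow> 'a) \<Rightarrow> bool" where
  "folding X m \<psi> \<longleftrightarrow>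
     \<psi> \<in> X \<rightarrow> X \<and>
     (\<forall>x\<in>X. \<forall>y\<in>X. \<forall>z\<in>X. \<psi> (m (x, y, z)) = m (\<psi> x, y, \<psi> z))"

definition locally_linear :: "'a set \<Rightarrow> ('a \<times> 'a \<times> 'a \<Rightarrow> 'a) \<Rightarrow> bool" where
  "locally_linear X m \<longleftrightarrow>
     (\<forall>x\<in>X. \<forall>y\<in>X. \<forall>z\<in>cell X m x y. cell X m x y = cell X m x z \<union> cell X m z y)"

definition simplicial :: "'a set \<Rightarrow> ('a \<times> 'a \<times> 'a \<Rightarrow> 'a) \<Rightarrow> bool" where
  "simplicial X m \<longleftrightarrow> (\<forall>x\<in>X. \<forall>y\<in>X. finite (cell X m x y))"

definition median_group :: "('g, 'r) monoid_scheme \<Rightarrow> ('g \<times> 'g \<times> 'g \<Rightarrow> 'g) \<Rightarrow> bool" where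
  "median_group G m \<longleftrightarrow>
     group G \<and> median_op (carrier G) m \<and>
     (\<forall>u\<in>carrier G. \<forall>x\<in>carrier G. \<forall>y\<in>carrier G. \<forall>z\<in>carrier G.
        u \<otimes>\<^bsub>G\<^esub> m (x, y, z) = m (u \<otimes>\<^bsub>G\<^esub> x, u \<otimes>\<^bsub>G\<^esub> y, u \<otimes>\<^bsub>G\<^esub> z))"

definition free_action :: "('h, 'r) monoid_scheme \<Rightarrow> 'x set \<Rightarrow> ('h \<Rightarrow> 'x \<Rightarrow> 'x) \<Rightarrow> bool" where
  "free_action H X act \<longleftrightarrow>
     group_action H X act \<and> (\<forall>h\<in>carrier H. \<forall>x\<in>X. act h x = x \<longrightarrow> h = \<one>\<^bsub>H\<^esub>)"

definition compatible_medians ::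
  "('h, 'r) monoid_scheme \<Rightarrow> 'x set \<Rightarrow> ('h \<Rightarrow> 'x \<Rightarrow> 'x) \<Rightarrow> ('x \<times> 'x \<times> 'x \<Rightarrow> 'x) set" where
  "compatible_medians H X act =
     {m. median_op X m \<and>
         (\<forall>h\<in>carrier H. \<forall>x\<in>X. \<forall>y\<in>X. \<forall>z\<in>X.
            m (act h x, act h y, act h z) = act h (m (x, y, z)))}"

definition median_extension ::
  "('g, 'r) monoid_scheme \<Rightarrow> 'x set \<Rightarrow> ('x \<Rightarrow> 'g) \<Rightarrow> ('g \<Rightarrow> 'x) \<Rightarrow>
   ('x \<times> 'x \<times> 'x \<Rightarrow> 'x) \<Rightarrow> ('g \<times> 'g \<times> 'g \<Rightarrow> 'g) \<Rightarrow> bool" where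
  "median_extension G X \<iota> \<phi> m mh \<longleftrightarrow>
     (\<forall>x\<in>X. \<forall>y\<in>X. \<forall>z\<in>X. mh (\<iota> x, \<iota> y, \<iota> z) = \<iota> (m (x, y, z))) \<and>
     median_group G mh \<and>
     folding (carrier G) mh (\<iota> \<circ> \<phi>) \<and>
     retractible (carrier G) mh (\<iota> ` X) \<and>
     associated_folding (carrier G) mh (\<iota> ` X) (\<iota> \<circ> \<phi>)"

text \<open>
  HOL cannot quantify existentially over types, so a group whose existence is asserted
  needs a fixed ambient type. A group generated by a copy of \<open>X :: 'x set\<close> has at most
  \<open>max \<aleph>\<^sub>0 |X|\<close> elements and hence an isomorphic copy carried by a subset of the type below,
  whose shape provides words in elements of \<open>H\<close> and signed elements of \<open>X\<close>.
\<close>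

type_synonym ('h, 'x) ambient = "('h + bool \<times> 'x) list"

end

theory Submission
  imports Defs "HOL-Algebra.Weak_Morphisms"
begin

text \<open>
  Choose a transversal \<open>B\<close> of the orbits with \<open>b1 \<in> B\<close>. As the action is free, every point is
  uniquely \<open>h b\<close> with \<open>h\<close> in \<open>H\<close> and \<open>b \<in> B\<close>. The group is the free product of \<open>H\<close> with the free
  group on \<open>B - {b1}\<close>, the embedding \<open>\<iota>\<close> sends the point \<open>h b\<close> to the product \<open>h b\<close>, and \<open>b1\<close>
  becomes \<open>1\<close>. The left translates of \<open>X\<close> correspond to the left cosets of \<open>H\<close>, and they fit together
  like a tree: distinct translates share at most one point, and any two elements are joined by
  exactly one reduced path that runs through successive translates. The map \<open>\<phi>\<close> sends an element
  to the point at which the path from \<open>X\<close> to it leaves \<open>X\<close>.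

  Reduced paths from \<open>1\<close> are lists of pairs \<open>(b, x)\<close>, read as products of quotients \<open>b\<inverse> x\<close>. They
  serve as normal forms, and are easier to multiply than alternating words in a free product
  because a path decomposes uniquely with respect to each translate through its origin
  (\<open>reduced_decompose\<close>, \<open>glue_decompose\<close>). Associativity becomes the identity
  \<open>(a\<inverse> h c) (c\<inverse> x) = a\<inverse> (h x)\<close>.

  The medians are handled coordinatewise. The projection of \<open>u\<close> to a translate of \<open>X\<close> is, after
  moving that translate back to \<open>X\<close>, the point \<open>\<phi> (k u)\<close> for some \<open>k\<close>. Two elements with the same
  projections are equal (\<open>words_separation\<close>). Every extension of \<open>m\<close> for which \<open>\<iota> \<circ> \<phi>\<close> is a
  folding acts on these coordinates as \<open>m\<close> (\<open>extension_coordinatewise\<close>), which gives uniqueness.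
  Conversely the median axioms, left invariance, the folding equation and the extension property
  hold as soon as they hold in each coordinate, so existence reduces to this: for any three
  elements, some element has the medians of their coordinates as its own coordinates. After a
  translation one of the three is \<open>1\<close>; the other two are paths from \<open>1\<close>, and the wanted element
  is their common initial part, completed by a median of \<open>X\<close> if they separate inside a
  translate (\<open>prefix_median\<close>, \<open>coordinate_prefix_median\<close>). For this one needs to know all
  coordinates of a path: they are given explicitly by \<open>proj\<close> (\<open>coordinate_is_proj\<close>).

  Finally, the cell from \<open>1\<close> to a path consists of its initial parts, the last step of which may
  stop anywhere in a cell of \<open>X\<close> (\<open>prefix_cell_Cons\<close>). It is therefore finite if the cells of \<open>X\<close>
  are finite, and linearly ordered if those are (\<open>prefix_cells_comparable\<close>).
\<close>


section \<open>Median operations\<close>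

lemma median_op_closed:
  "\<lbrakk>median_op X m; x \<in> X; y \<in> X; z \<in> X\<rbrakk> \<Longrightarrow> m (x, y, z) \<in> X"
  unfolding median_op_def by (meson PiE_mem SigmaI)

lemma median_op_swap:
  assumes "median_op X m" "x \<in> X" "y \<in> X" "z \<in> X"
  shows "m (y, x, z) = m (x, y, z)" "m (x, z, y) = m (x, y, z)"
  using assms unfolding median_op_def by metis+

lemma median_op_majority:
  assumes "median_op X m" "x \<in> X" "y \<in> X"
  shows "m (x, x, y) = x" "m (x, y, x) = x" "m (y, x, x) = x"
  using assms unfolding median_op_def by metis+

lemma median_op_distrib:
  assumes "median_op X m" "x \<in> X" "y \<in> X" "z \<in> X" "u \<in> X" "v \<in> X"
  shows "m (m (x, y, z), u, v) = m (m (x, u, v), m (y, u, v), z)"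
  using assms unfolding median_op_def by blast

lemma cell_mono:
  assumes m: "median_op X m" and "x \<in> X" "y \<in> X" "z \<in> cell X m x y" "w \<in> cell X m x z"
  shows "w \<in> cell X m x y"
proof -
  have X: "z \<in> X" "w \<in> X" and z: "m (x, y, z) = z" and w: "m (x, z, w) = w"
    using assms by (auto simp: cell_def)
  have "m (x, y, w) = m (m (x, z, w), x, y)"
    using w median_op_swap[OF m, of _ _ _] assms(2,3) X by metis
  also have "\<dots> = m (m (x, x, y), m (z, x, y), w)"
    using median_op_distrib[OF m] assms(2,3) X by blast
  also have "\<dots> = m (x, z, w)"
    using z median_op_swap[OF m] median_op_majority[OF m] assms(2,3) X by metis
  finally show ?thesis using w X by (simp add: cell_def)
qed

lemma cell_sym:
  assumes "median_op X m" "x \<in> X" "y \<in> X"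
  shows "cell X m y x = cell X m x y"
  using median_op_swap(1)[OF assms(1)] assms(2,3) by (auto simp: cell_def)

text \<open>
  If \<open>x, z, w, y\<close> occur in this order along a cell then \<open>w\<close> is also between \<open>z\<close> and \<open>y\<close>.
  Hence a cell whose points are linearly ordered from one endpoint is cut in two by each of
  its points.
\<close>

lemma cell_complement:
  assumes m: "median_op X m" and "x \<in> X" "y \<in> X" "w \<in> cell X m x y" "z \<in> cell X m x w"
  shows "w \<in> cell X m z y"
proof -
  have X: "z \<in> X" "w \<in> X" and w: "m (x, y, w) = w" and z: "m (x, w, z) = z"
    using assms by (auto simp: cell_def)
  have "m (z, y, w) = m (m (x, w, z), y, w)" using z by simp
  also have "\<dots> = m (m (x, y, w), m (w, y, w), z)"
    using median_op_distrib[OF m] assms(2,3) X by blast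
  also have "\<dots> = w"
    using w median_op_majority[OF m] assms(3) X by simp
  finally show ?thesis using X by (simp add: cell_def)
qed

lemma locally_linear_if_cells_comparable:
  assumes m: "median_op X m"
    and cmp: "\<And>x y z w. \<lbrakk>x \<in> X; y \<in> X; z \<in> cell X m x y; w \<in> cell X m x y\<rbrakk>
      \<Longrightarrow> w \<in> cell X m x z \<or> z \<in> cell X m x w"
  shows "locally_linear X m"
  unfolding locally_linear_def
proof (intro ballI equalityI subsetI)
  fix x y z w assume X: "x \<in> X" "y \<in> X" and z: "z \<in> cell X m x y" and w: "w \<in> cell X m x y"
  show "w \<in> cell X m x z \<union> cell X m z y"
    using cmp[OF X z w] cell_complement[OF m X w] by blast
next
  fix x y z w assume X: "x \<in> X" "y \<in> X" and z: "z \<in> cell X m x y"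
    and w: "w \<in> cell X m x z \<union> cell X m z y"
  have zX: "z \<in> X" using z by (simp add: cell_def)
  show "w \<in> cell X m x y"
    using w cell_mono[OF m X z] cell_mono[OF m X(2,1), of z w] z
      cell_sym[OF m X] cell_sym[OF m zX X(2)] by blast
qed


section \<open>Free actions with a base point\<close>

locale pointed_free_action =
  fixes H :: "('h, 'r) monoid_scheme" and X :: "'x set" and act :: "'h \<Rightarrow> 'x \<Rightarrow> 'x" and b1 :: 'x
  assumes H_group: "group H" and free_action: "free_action H X act" and base_in: "b1 \<in> X"
begin

sublocale H: group H by (rule H_group)
sublocale group_action H X act using free_action by (simp add: free_action_def)

lemma act_closed [simp]: "\<lbrakk>h \<in> carrier H; x \<in> X\<rbrakk> \<Longrightarrow> act h x \<in> X"
  using element_image by blast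

lemma act_mult: "\<lbrakk>h \<in> carrier H; k \<in> carrier H; x \<in> X\<rbrakk> \<Longrightarrow> act (h \<otimes>\<^bsub>H\<^esub> k) x = act h (act k x)"
  by (rule composition_rule)

lemma act_one [simp]: "x \<in> X \<Longrightarrow> act \<one>\<^bsub>H\<^esub> x = x"
  by (metis id_eq_one restrict_apply')

lemma act_inv [simp]:
  "\<lbrakk>h \<in> carrier H; x \<in> X\<rbrakk> \<Longrightarrow> act (inv\<^bsub>H\<^esub> h) (act h x) = x"
  "\<lbrakk>h \<in> carrier H; x \<in> X\<rbrakk> \<Longrightarrow> act h (act (inv\<^bsub>H\<^esub> h) x) = x"
  by (simp_all flip: act_mult)

lemma act_free:
  assumes "h \<in> carrier H" "k \<in> carrier H" "x \<in> X" "act h x = act k x"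
  shows "h = k"
proof -
  have "act (inv\<^bsub>H\<^esub> h \<otimes>\<^bsub>H\<^esub> k) x = x"
    using assms by (simp add: act_mult flip: assms(4))
  then have "inv\<^bsub>H\<^esub> h \<otimes>\<^bsub>H\<^esub> k = \<one>\<^bsub>H\<^esub>"
    using free_action assms unfolding free_action_def by (meson H.inv_closed H.m_closed)
  then show ?thesis using assms by (metis H.inv_equality H.inv_inv H.inv_closed)
qed

lemma compatible_median:
  assumes "m \<in> compatible_medians H X act"
  shows "median_op X m"
    "\<lbrakk>h \<in> carrier H; x \<in> X; y \<in> X; z \<in> X\<rbrakk> \<Longrightarrow> m (act h x, act h y, act h z) = act h (m (x, y, z))"
  using assms by (auto simp: compatible_medians_def)

text \<open>
  Freeness makes \<open>X\<close> a product of \<open>H\<close> with a transversal of the orbits: each point is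
  \<open>act (coord x) (rep x)\<close> in exactly one way. The transversal contains the base point.
\<close>

definition rep :: "'x \<Rightarrow> 'x" where
  "rep x = (if x \<in> orbit H act b1 then b1 else SOME y. y \<in> orbit H act x)"

definition coord :: "'x \<Rightarrow> 'h" where
  "coord x = (THE h. h \<in> carrier H \<and> act h (rep x) = x)"

lemma orbit_act: assumes "h \<in> carrier H" "x \<in> X" shows "orbit H act (act h x) = orbit H act x"
proof -
  have "act h x \<in> orbit H act x" using assms by (auto simp: orbit_def)
  moreover have "orbit H act y \<subseteq> X" if "y \<in> X" for y using that by (auto simp: orbit_def)
  ultimately show ?thesis
    using assms orbit_trans orbit_sym by (meson act_closed subsetD subsetI subset_antisym)
qed

lemma rep_in_orbit: "x \<in> X \<Longrightarrow> rep x \<in> orbit H act x"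
  unfolding rep_def
  by (metis (full_types) base_in orbit_refl orbit_sym someI_ex)

lemma rep_closed [simp]: "x \<in> X \<Longrightarrow> rep x \<in> X"
  using rep_in_orbit[of x] by (auto simp: orbit_def)

lemma rep_act [simp]: assumes "h \<in> carrier H" "x \<in> X" shows "rep (act h x) = rep x"
proof -
  have "y \<in> orbit H act b1 \<longleftrightarrow> b1 \<in> orbit H act y" if "y \<in> X" for y
    using orbit_sym base_in that by blast
  then show ?thesis using orbit_act[OF assms] assms by (simp add: rep_def)
qed

lemma rep_rep [simp]: "x \<in> X \<Longrightarrow> rep (rep x) = rep x"
  using rep_in_orbit[of x] by (auto simp: orbit_def)

lemma rep_base [simp]: "rep b1 = b1"
  using orbit_refl[OF base_in] by (simp add: rep_def)

lemma coord: assumes "x \<in> X" shows "coord x \<in> carrier H \<and> act (coord x) (rep x) = x"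
proof -
  obtain h where h: "h \<in> carrier H" "act h x = rep x"
    using rep_in_orbit[OF assms] by (auto simp: orbit_def)
  have "inv\<^bsub>H\<^esub> h \<in> carrier H \<and> act (inv\<^bsub>H\<^esub> h) (rep x) = x"
    using h assms by (simp flip: h(2))
  then have "\<exists>!h. h \<in> carrier H \<and> act h (rep x) = x"
    using act_free assms rep_closed by metis
  then show ?thesis unfolding coord_def by (rule theI')
qed

lemma coord_closed [simp]: "x \<in> X \<Longrightarrow> coord x \<in> carrier H"
  and act_coord [simp]: "x \<in> X \<Longrightarrow> act (coord x) (rep x) = x"
  using coord by blast+

lemma coord_act [simp]:
  assumes "h \<in> carrier H" "x \<in> X" shows "coord (act h x) = h \<otimes>\<^bsub>H\<^esub> coord x"
  using act_free[of "coord (act h x)" "h \<otimes>\<^bsub>H\<^esub> coord x" "rep x"] act_coord[of "act h x"] assms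
  by (simp add: act_mult)

lemma coord_rep [simp]: "\<lbrakk>x \<in> X; rep x = x\<rbrakk> \<Longrightarrow> coord x = \<one>\<^bsub>H\<^esub>"
  using act_free[of "coord x" "\<one>\<^bsub>H\<^esub>" x] act_coord[of x] by simp

end


section \<open>Median operations determined by their coordinates\<close>

text \<open>
  These are the only properties of the group under construction on which the medians depend.
  The coordinates of \<open>u\<close> are the points \<open>\<phi> (k \<otimes> u)\<close>; they separate the elements of \<open>G\<close>, so \<open>G\<close>
  sits inside a power of \<open>X\<close>, and \<open>coords_median\<close> says that it is closed under every compatible
  median of that power. The assumption \<open>shadow\<close> is the geometry behind the folding: the
  projection to a translate of \<open>X\<close> either is \<open>\<phi>\<close> up to \<open>H\<close>, or squeezes \<open>X\<close> to a point. The last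
  two assumptions speak only of the cells that start at \<open>\<one>\<close>, which is enough because \<open>G\<close> acts
  transitively on itself.
\<close>

locale coordinate_group = pointed_free_action H X act b1 + group G
  for H :: "('h, 'r) monoid_scheme" and X :: "'x set" and act b1
    and G :: "('g, 's) monoid_scheme" (structure) +
  fixes j :: "'h \<Rightarrow> 'g" and \<iota> :: "'x \<Rightarrow> 'g" and \<phi> :: "'g \<Rightarrow> 'x"
  assumes j_mon: "j \<in> mon H G"
    and \<iota>_closed: "x \<in> X \<Longrightarrow> \<iota> x \<in> carrier G"
    and \<phi>_closed: "u \<in> carrier G \<Longrightarrow> \<phi> u \<in> X"
    and \<phi>_\<iota>: "x \<in> X \<Longrightarrow> \<phi> (\<iota> x) = x"
    and \<iota>_act: "\<lbrakk>h \<in> carrier H; x \<in> X\<rbrakk> \<Longrightarrow> \<iota> (act h x) = j h \<otimes> \<iota> x"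
    and \<phi>_act: "\<lbrakk>h \<in> carrier H; u \<in> carrier G\<rbrakk> \<Longrightarrow> \<phi> (j h \<otimes> u) = act h (\<phi> u)"
    and \<iota>_base: "\<iota> b1 = \<one>"
    and \<iota>_generates: "carrier G \<subseteq> generate G (\<iota> ` X)"
    and separation:
      "\<lbrakk>u \<in> carrier G; v \<in> carrier G; \<forall>k\<in>carrier G. \<phi> (k \<otimes> u) = \<phi> (k \<otimes> v)\<rbrakk> \<Longrightarrow> u = v"
    and coords_median:
      "\<lbrakk>m \<in> compatible_medians H X act; y \<in> carrier G; z \<in> carrier G; w \<in> carrier G\<rbrakk>
        \<Longrightarrow> \<exists>u\<in>carrier G. \<forall>k\<in>carrier G. \<phi> (k \<otimes> u) = m (\<phi> (k \<otimes> y), \<phi> (k \<otimes> z), \<phi> (k \<otimes> w))"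
    and shadow:
      "k \<in> carrier G \<Longrightarrow>
        (\<exists>h\<in>carrier H. \<forall>u\<in>carrier G. \<phi> (k \<otimes> u) = act h (\<phi> u)) \<or>
        (\<exists>c. \<forall>x\<in>X. \<phi> (k \<otimes> \<iota> x) = c)"
    and cells_comparable:
      "\<lbrakk>m \<in> compatible_medians H X act; locally_linear X m;
        y \<in> carrier G; z \<in> carrier G; w \<in> carrier G;
        \<forall>k\<in>carrier G. m (\<phi> k, \<phi> (k \<otimes> y), \<phi> (k \<otimes> z)) = \<phi> (k \<otimes> z);
        \<forall>k\<in>carrier G. m (\<phi> k, \<phi> (k \<otimes> y), \<phi> (k \<otimes> w)) = \<phi> (k \<otimes> w)\<rbrakk>
        \<Longrightarrow> (\<forall>k\<in>carrier G. m (\<phi> k, \<phi> (k \<otimes> z), \<phi> (k \<otimes> w)) = \<phi> (k \<otimes> w)) \<or>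
            (\<forall>k\<in>carrier G. m (\<phi> k, \<phi> (k \<otimes> w), \<phi> (k \<otimes> z)) = \<phi> (k \<otimes> z))"
    and cells_finite:
      "\<lbrakk>m \<in> compatible_medians H X act; simplicial X m; y \<in> carrier G\<rbrakk>
        \<Longrightarrow> finite {z \<in> carrier G. \<forall>k\<in>carrier G. m (\<phi> k, \<phi> (k \<otimes> y), \<phi> (k \<otimes> z)) = \<phi> (k \<otimes> z)}"
begin

definition coordinatewise :: "('x \<times> 'x \<times> 'x \<Rightarrow> 'x) \<Rightarrow> ('g \<times> 'g \<times> 'g \<Rightarrow> 'g) \<Rightarrow> bool" where
  "coordinatewise m M \<longleftrightarrow>
     M \<in> carrier G \<times> carrier G \<times> carrier G \<rightarrow>\<^sub>E carrier G \<and>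
     (\<forall>x\<in>carrier G. \<forall>y\<in>carrier G. \<forall>z\<in>carrier G. \<forall>k\<in>carrier G.
        \<phi> (k \<otimes> M (x, y, z)) = m (\<phi> (k \<otimes> x), \<phi> (k \<otimes> y), \<phi> (k \<otimes> z)))"

lemma coordinatewise_closed:
  "\<lbrakk>coordinatewise m M; x \<in> carrier G; y \<in> carrier G; z \<in> carrier G\<rbrakk> \<Longrightarrow> M (x, y, z) \<in> carrier G"
  unfolding coordinatewise_def by (meson PiE_mem SigmaI)

lemma coordinatewise_apply:
  "\<lbrakk>coordinatewise m M; x \<in> carrier G; y \<in> carrier G; z \<in> carrier G; k \<in> carrier G\<rbrakk>
    \<Longrightarrow> \<phi> (k \<otimes> M (x, y, z)) = m (\<phi> (k \<otimes> x), \<phi> (k \<otimes> y), \<phi> (k \<otimes> z))"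
  by (simp add: coordinatewise_def)

lemma coordinatewise_apply_one:
  "\<lbrakk>coordinatewise m M; x \<in> carrier G; y \<in> carrier G; z \<in> carrier G\<rbrakk>
    \<Longrightarrow> \<phi> (M (x, y, z)) = m (\<phi> x, \<phi> y, \<phi> z)"
  using coordinatewise_apply[of m M x y z \<one>] coordinatewise_closed[of m M x y z] by simp

lemma coordinatewise_exists:
  assumes m: "m \<in> compatible_medians H X act"
  shows "\<exists>M. coordinatewise m M"
proof -
  let ?C = "carrier G"
  have "\<forall>t\<in>?C \<times> ?C \<times> ?C. \<exists>u\<in>?C. \<forall>k\<in>?C.
      \<phi> (k \<otimes> u) = m (\<phi> (k \<otimes> fst t), \<phi> (k \<otimes> fst (snd t)), \<phi> (k \<otimes> snd (snd t)))"
    using coords_median[OF m] by auto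
  then obtain M where M: "\<forall>t\<in>?C \<times> ?C \<times> ?C. M t \<in> ?C \<and> (\<forall>k\<in>?C.
      \<phi> (k \<otimes> M t) = m (\<phi> (k \<otimes> fst t), \<phi> (k \<otimes> fst (snd t)), \<phi> (k \<otimes> snd (snd t))))"
    using bchoice[of "?C \<times> ?C \<times> ?C" "\<lambda>t u. u \<in> ?C \<and> (\<forall>k\<in>?C.
      \<phi> (k \<otimes> u) = m (\<phi> (k \<otimes> fst t), \<phi> (k \<otimes> fst (snd t)), \<phi> (k \<otimes> snd (snd t))))"] by blast
  have "coordinatewise m (restrict M (?C \<times> ?C \<times> ?C))"
    using M by (auto simp: coordinatewise_def)
  then show ?thesis by blast
qed

lemma coordinatewise_unique:
  assumes M: "coordinatewise m M" and N: "coordinatewise m N"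
  shows "M = N"
proof (rule PiE_ext)
  show "M \<in> carrier G \<times> carrier G \<times> carrier G \<rightarrow>\<^sub>E carrier G"
    "N \<in> carrier G \<times> carrier G \<times> carrier G \<rightarrow>\<^sub>E carrier G"
    using assms by (auto simp: coordinatewise_def)
  fix t assume "t \<in> carrier G \<times> carrier G \<times> carrier G"
  then obtain x y z where t: "t = (x, y, z)" "x \<in> carrier G" "y \<in> carrier G" "z \<in> carrier G"
    by auto
  show "M t = N t"
    unfolding t(1) using t(2-) coordinatewise_apply[OF M] coordinatewise_apply[OF N]
    by (intro separation) (simp_all add: coordinatewise_closed[OF M] coordinatewise_closed[OF N])
qed

text \<open>The median axioms are equations, so they pass from \<open>X\<close> to \<open>G\<close> one coordinate at a time.\<close>

lemma coordinatewise_median_group: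
  assumes m: "m \<in> compatible_medians H X act" and M: "coordinatewise m M"
  shows "median_group G M"
proof -
  note mX = compatible_median(1)[OF m]
  note cl = coordinatewise_closed[OF M] and ap = coordinatewise_apply[OF M]
  have "median_op (carrier G) M"
    unfolding median_op_def
  proof (intro conjI ballI)
    show "M \<in> carrier G \<times> carrier G \<times> carrier G \<rightarrow>\<^sub>E carrier G"
      using M by (simp add: coordinatewise_def)
  next
    fix x y z assume "x \<in> carrier G" "y \<in> carrier G" "z \<in> carrier G"
    then show "M (x, y, z) = M (y, x, z)" "M (x, y, z) = M (x, z, y)"
      by (intro separation; simp add: cl ap \<phi>_closed median_op_swap[OF mX])+
  next
    fix x y assume "x \<in> carrier G" "y \<in> carrier G"
    then show "M (x, y, x) = x"
      by (intro separation; simp add: cl ap \<phi>_closed median_op_majority[OF mX])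
  next
    fix x y z u v
    assume xs: "x \<in> carrier G" "y \<in> carrier G" "z \<in> carrier G" "u \<in> carrier G" "v \<in> carrier G"
    have "\<phi> (k \<otimes> M (M (x, y, z), u, v)) = \<phi> (k \<otimes> M (M (x, u, v), M (y, u, v), z))"
      if "k \<in> carrier G" for k
      using xs that median_op_distrib[OF mX, of "\<phi> (k \<otimes> x)" "\<phi> (k \<otimes> y)" "\<phi> (k \<otimes> z)"]
      by (simp add: cl ap \<phi>_closed)
    then show "M (M (x, y, z), u, v) = M (M (x, u, v), M (y, u, v), z)"
      using xs by (intro separation; simp add: cl)
  qed
  moreover have "u \<otimes> M (x, y, z) = M (u \<otimes> x, u \<otimes> y, u \<otimes> z)"
    if "u \<in> carrier G" "x \<in> carrier G" "y \<in> carrier G" "z \<in> carrier G" for u x y z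
    using that by (intro separation) (simp_all add: cl ap flip: m_assoc)
  ultimately show ?thesis by (simp add: median_group_def)
qed

text \<open>
  For a coordinate \<open>k\<close> in which \<open>X\<close> is a single point both sides of the folding equation have
  that point as a majority; in the other coordinates \<open>\<phi>\<close> is invisible.
\<close>

lemma coordinatewise_folding:
  assumes m: "m \<in> compatible_medians H X act" and M: "coordinatewise m M"
  shows "folding (carrier G) M (\<iota> \<circ> \<phi>)"
  unfolding folding_def
proof (intro conjI ballI)
  show "\<iota> \<circ> \<phi> \<in> carrier G \<rightarrow> carrier G" by (simp add: \<iota>_closed \<phi>_closed)
  note mX = compatible_median(1)[OF m]
  note cl = coordinatewise_closed[OF M] and ap = coordinatewise_apply[OF M]
    and ap1 = coordinatewise_apply_one[OF M]
  fix x y z assume xs: "x \<in> carrier G" "y \<in> carrier G" "z \<in> carrier G"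
  have "\<phi> (k \<otimes> \<iota> (m (\<phi> x, \<phi> y, \<phi> z))) = m (\<phi> (k \<otimes> \<iota> (\<phi> x)), \<phi> (k \<otimes> y), \<phi> (k \<otimes> \<iota> (\<phi> z)))"
    if k: "k \<in> carrier G" for k
    using shadow[OF k]
  proof
    assume "\<exists>h\<in>carrier H. \<forall>u\<in>carrier G. \<phi> (k \<otimes> u) = act h (\<phi> u)"
    then obtain h where "h \<in> carrier H" "\<forall>u\<in>carrier G. \<phi> (k \<otimes> u) = act h (\<phi> u)" by blast
    then show ?thesis
      using xs by (simp add: \<iota>_closed \<phi>_closed \<phi>_\<iota> median_op_closed[OF mX] compatible_median(2)[OF m])
  next
    assume "\<exists>c. \<forall>x\<in>X. \<phi> (k \<otimes> \<iota> x) = c"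
    then obtain c where c: "\<forall>x\<in>X. \<phi> (k \<otimes> \<iota> x) = c" by blast
    then have "c \<in> X" using base_in \<phi>_closed \<iota>_closed k by (metis m_closed)
    then show ?thesis
      using c xs k by (simp add: \<phi>_closed median_op_closed[OF mX] median_op_majority[OF mX])
  qed
  then show "(\<iota> \<circ> \<phi>) (M (x, y, z)) = M ((\<iota> \<circ> \<phi>) x, y, (\<iota> \<circ> \<phi>) z)"
    using xs by (intro separation)
      (simp_all add: cl ap ap1 \<iota>_closed \<phi>_closed median_op_closed[OF mX])
qed

text \<open>
  The folding equation fixes every point between two points of the image, which gives
  convexity. Applied to a triple \<open>x, a, z\<close> with \<open>a\<close> and \<open>z\<close> in the image, it replaces \<open>x\<close> by its
  image, which is therefore the gate of \<open>x\<close>.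
\<close>

lemma folding_retractible:
  assumes M: "median_op (carrier G) M" and f: "folding (carrier G) M (\<iota> \<circ> \<phi>)"
  shows "retractible (carrier G) M (\<iota> ` X) \<and> associated_folding (carrier G) M (\<iota> ` X) (\<iota> \<circ> \<phi>)"
proof -
  let ?C = "carrier G" and ?f = "\<iota> \<circ> \<phi>" and ?X = "\<iota> ` X"
  have fold: "?f (M (x, y, z)) = M (?f x, y, ?f z)" if "x \<in> ?C" "y \<in> ?C" "z \<in> ?C" for x y z
    using f that unfolding folding_def by blast
  have XC: "a \<in> ?C" if "a \<in> ?X" for a using that \<iota>_closed by auto
  have fX: "?f x \<in> ?X" if "x \<in> ?C" for x using that \<phi>_closed by auto
  have fid: "?f a = a" if "a \<in> ?X" for a using that \<phi>_\<iota> by auto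
  have conv: "cell ?C M a b \<subseteq> ?X" if ab: "a \<in> ?X" "b \<in> ?X" for a b
  proof
    fix z assume "z \<in> cell ?C M a b"
    then have z: "z \<in> ?C" "M (a, b, z) = z" by (auto simp: cell_def)
    then have z': "M (a, z, b) = z" using median_op_swap(2)[OF M] XC ab by metis
    then have "?f z = z" using fold[of a z b] XC fid ab z by simp
    then show "z \<in> ?X" using fX z(1) by metis
  qed
  have gate: "cell ?C M x a \<inter> ?X = cell ?C M (?f x) a" if x: "x \<in> ?C" and a: "a \<in> ?X" for x a
  proof (intro equalityI subsetI)
    fix z assume "z \<in> cell ?C M x a \<inter> ?X"
    then have z: "z \<in> ?C" "M (x, a, z) = z" "z \<in> ?X" by (auto simp: cell_def)
    then have "M (?f x, a, z) = z" using fold[OF x XC[OF a] z(1)] fid by simp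
    then show "z \<in> cell ?C M (?f x) a" using z by (simp add: cell_def)
  next
    fix z assume zc: "z \<in> cell ?C M (?f x) a"
    then have z: "z \<in> ?C" "M (?f x, a, z) = z" by (auto simp: cell_def)
    have zX: "z \<in> ?X" using zc conv fX[OF x] a by blast
    let ?w = "M (x, a, z)"
    have w: "?w \<in> ?C" using median_op_closed[OF M] x XC a z(1) by blast
    \<comment> \<open>The median of \<open>x, a, z\<close> lies between \<open>a\<close> and \<open>z\<close>, hence in the convex image.\<close>
    have "M (a, z, ?w) = ?w"
    proof -
      have "M (?w, a, z) = M (M (a, z, x), a, z)"
        using median_op_swap[OF M] x XC[OF a] z(1) by metis
      also have "\<dots> = M (M (a, a, z), M (z, a, z), x)"
        using median_op_distrib[OF M XC[OF a] z(1) x XC[OF a] z(1)] .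
      also have "\<dots> = ?w"
        using median_op_majority[OF M] median_op_swap[OF M] x XC[OF a] z(1) by metis
      finally show ?thesis using median_op_swap[OF M] w XC[OF a] z(1) by metis
    qed
    then have "?w \<in> ?X" using conv[OF a zX] w by (auto simp: cell_def)
    then have "?w = z" using fold[OF x XC[OF a] z(1)] fid zX z(2) by simp
    then show "z \<in> cell ?C M x a \<inter> ?X" using zX z(1) by (simp add: cell_def)
  qed
  show ?thesis
    unfolding retractible_def associated_folding_def median_convex_def
    using base_in conv gate fX XC by (intro conjI ballI bexI) auto
qed

lemma coordinatewise_extends:
  assumes m: "m \<in> compatible_medians H X act" and M: "coordinatewise m M"
  shows "median_extension G X \<iota> \<phi> m M"
proof -
  note mg = coordinatewise_median_group[OF assms] and f = coordinatewise_folding[OF assms]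
  have mop: "median_op (carrier G) M" using mg by (simp add: median_group_def)
  have "M (\<iota> x, \<iota> y, \<iota> z) = \<iota> (m (x, y, z))" if "x \<in> X" "y \<in> X" "z \<in> X" for x y z
    \<comment> \<open>By the folding equation this value is fixed by \<open>\<iota> \<circ> \<phi>\<close>, so \<open>\<phi>\<close> determines it.\<close>
  proof -
    have "\<iota> (\<phi> (M (\<iota> x, \<iota> y, \<iota> z))) = M (\<iota> (\<phi> (\<iota> x)), \<iota> y, \<iota> (\<phi> (\<iota> z)))"
      using f that \<iota>_closed unfolding folding_def by (metis comp_apply)
    then show ?thesis
      using that coordinatewise_apply_one[OF M, of "\<iota> x" "\<iota> y" "\<iota> z"] by (simp add: \<iota>_closed \<phi>_\<iota>)
  qed
  then show ?thesis
    using mg f folding_retractible[OF mop f] unfolding median_extension_def by blast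
qed

text \<open>
  Conversely, applying the folding equation twice shows that \<open>\<phi>\<close> carries any extension to \<open>m\<close>,
  and left invariance turns this single coordinate into all of them.
\<close>

lemma extension_coordinatewise:
  assumes m: "m \<in> compatible_medians H X act" and ext: "median_extension G X \<iota> \<phi> m M"
  shows "coordinatewise m M"
proof -
  let ?C = "carrier G"
  have ex: "\<And>x y z. \<lbrakk>x \<in> X; y \<in> X; z \<in> X\<rbrakk> \<Longrightarrow> M (\<iota> x, \<iota> y, \<iota> z) = \<iota> (m (x, y, z))"
    and mop: "median_op ?C M"
    and inv: "\<And>u x y z. \<lbrakk>u \<in> ?C; x \<in> ?C; y \<in> ?C; z \<in> ?C\<rbrakk> \<Longrightarrow> u \<otimes> M (x, y, z) = M (u \<otimes> x, u \<otimes> y, u \<otimes> z)"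
    and fold: "\<And>x y z. \<lbrakk>x \<in> ?C; y \<in> ?C; z \<in> ?C\<rbrakk> \<Longrightarrow> \<iota> (\<phi> (M (x, y, z))) = M (\<iota> (\<phi> x), y, \<iota> (\<phi> z))"
    using ext unfolding median_extension_def median_group_def folding_def by auto
  note mX = compatible_median(1)[OF m]
  have \<phi>M: "\<phi> (M (x, y, z)) = m (\<phi> x, \<phi> y, \<phi> z)" if xs: "x \<in> ?C" "y \<in> ?C" "z \<in> ?C" for x y z
  proof -
    let ?a = "\<iota> (\<phi> x)" and ?b = "\<iota> (\<phi> y)" and ?c = "\<iota> (\<phi> z)"
    have C: "?a \<in> ?C" "?b \<in> ?C" "?c \<in> ?C" using xs by (simp_all add: \<iota>_closed \<phi>_closed)
    have "\<phi> (M (x, y, z)) = \<phi> (M (?a, y, ?c))"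
      using fold[OF xs] \<phi>_\<iota>[of "\<phi> (M (x, y, z))"] xs median_op_closed[OF mop] by (simp add: \<phi>_closed)
    also have "\<dots> = \<phi> (\<iota> (\<phi> (M (y, ?a, ?c))))"
      using median_op_swap[OF mop xs(2) C(1,3)] median_op_closed[OF mop xs(2) C(1,3)]
      by (simp add: \<phi>_\<iota> \<phi>_closed)
    also have "\<dots> = \<phi> (M (?b, ?a, ?c))"
      using fold[OF xs(2) C(1,3)] xs by (simp add: \<phi>_\<iota> \<phi>_closed)
    also have "\<dots> = m (\<phi> y, \<phi> x, \<phi> z)"
      using xs by (simp add: ex \<phi>_\<iota> \<phi>_closed median_op_closed[OF mX])
    finally show ?thesis using xs by (simp add: \<phi>_closed median_op_swap[OF mX])
  qed
  show ?thesis
    unfolding coordinatewise_def using mop inv \<phi>M by (simp add: median_op_def)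
qed

lemma coordinatewise_cell:
  assumes "coordinatewise m M" "x \<in> carrier G" "y \<in> carrier G"
  shows "z \<in> cell (carrier G) M x y \<longleftrightarrow> z \<in> carrier G \<and>
    (\<forall>k\<in>carrier G. m (\<phi> (k \<otimes> x), \<phi> (k \<otimes> y), \<phi> (k \<otimes> z)) = \<phi> (k \<otimes> z))"
proof (cases "z \<in> carrier G")
  case True
  have "M (x, y, z) = z \<longleftrightarrow> (\<forall>k\<in>carrier G. \<phi> (k \<otimes> M (x, y, z)) = \<phi> (k \<otimes> z))"
    using separation coordinatewise_closed[OF assms True] True by metis
  then show ?thesis
    using True assms by (simp add: cell_def coordinatewise_apply)
qed (simp add: cell_def)

lemma coordinatewise_cell_from_one:
  assumes "coordinatewise m M" "y \<in> carrier G"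
  shows "z \<in> cell (carrier G) M \<one> y \<longleftrightarrow> z \<in> carrier G \<and>
    (\<forall>k\<in>carrier G. m (\<phi> k, \<phi> (k \<otimes> y), \<phi> (k \<otimes> z)) = \<phi> (k \<otimes> z))"
  using coordinatewise_cell[OF assms(1) one_closed assms(2)] by simp

lemma median_group_cell_translate:
  assumes M: "median_group G M" and "x \<in> carrier G" "y \<in> carrier G" "z \<in> carrier G"
  shows "z \<in> cell (carrier G) M x y \<longleftrightarrow> inv x \<otimes> z \<in> cell (carrier G) M \<one> (inv x \<otimes> y)"
proof -
  have mop: "median_op (carrier G) M" using M by (simp add: median_group_def)
  have "inv x \<otimes> M (x, y, z) = M (inv x \<otimes> x, inv x \<otimes> y, inv x \<otimes> z)"
    using assms unfolding median_group_def by (metis inv_closed)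
  then have "M (\<one>, inv x \<otimes> y, inv x \<otimes> z) = inv x \<otimes> M (x, y, z)" using assms by simp
  then show ?thesis
    using assms median_op_closed[OF mop] by (simp add: cell_def)
qed

lemma coordinatewise_locally_linear:
  assumes m: "m \<in> compatible_medians H X act" and M: "coordinatewise m M"
    and lin: "locally_linear X m"
  shows "locally_linear (carrier G) M"
proof -
  note mg = coordinatewise_median_group[OF m M]
  then have mop: "median_op (carrier G) M" by (simp add: median_group_def)
  show ?thesis
  proof (rule locally_linear_if_cells_comparable[OF mop])
    fix x y z w
    assume x: "x \<in> carrier G" and y: "y \<in> carrier G"
      and z: "z \<in> cell (carrier G) M x y" and w: "w \<in> cell (carrier G) M x y"
    have zw: "z \<in> carrier G" "w \<in> carrier G" using z w by (auto simp: cell_def)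
    note tr = median_group_cell_translate[OF mg x]
    note one = coordinatewise_cell_from_one[OF M]
    have "inv x \<otimes> w \<in> cell (carrier G) M \<one> (inv x \<otimes> z) \<or> inv x \<otimes> z \<in> cell (carrier G) M \<one> (inv x \<otimes> w)"
      using z w x y zw cells_comparable[OF m lin, of "inv x \<otimes> y" "inv x \<otimes> z" "inv x \<otimes> w"]
      unfolding tr[OF y zw(1)] tr[OF y zw(2)] by (simp add: one)
    then show "w \<in> cell (carrier G) M x z \<or> z \<in> cell (carrier G) M x w"
      using tr zw by blast
  qed
qed

lemma coordinatewise_simplicial:
  assumes m: "m \<in> compatible_medians H X act" and M: "coordinatewise m M"
    and fin: "simplicial X m"
  shows "simplicial (carrier G) M"
  unfolding simplicial_def
proof (intro ballI)
  note mg = coordinatewise_median_group[OF m M]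
  fix x y assume x: "x \<in> carrier G" and y: "y \<in> carrier G"
  have "cell (carrier G) M \<one> (inv x \<otimes> y) = {z \<in> carrier G. \<forall>k\<in>carrier G.
      m (\<phi> k, \<phi> (k \<otimes> (inv x \<otimes> y)), \<phi> (k \<otimes> z)) = \<phi> (k \<otimes> z)}"
    using coordinatewise_cell_from_one[OF M, of "inv x \<otimes> y"] x y by (simp add: set_eq_iff)
  then have fin1: "finite (cell (carrier G) M \<one> (inv x \<otimes> y))"
    using cells_finite[OF m fin, of "inv x \<otimes> y"] x y by simp
  have "cell (carrier G) M x y \<subseteq> (\<otimes>) x ` cell (carrier G) M \<one> (inv x \<otimes> y)"
  proof
    fix z assume z: "z \<in> cell (carrier G) M x y"
    then have zG: "z \<in> carrier G" by (simp add: cell_def)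
    have "z = x \<otimes> (inv x \<otimes> z)" using x zG by (simp flip: m_assoc)
    then show "z \<in> (\<otimes>) x ` cell (carrier G) M \<one> (inv x \<otimes> y)"
      using z median_group_cell_translate[OF mg x y zG] by blast
  qed
  then show "finite (cell (carrier G) M x y)" using fin1 finite_surj by blast
qed

lemma median_extension_unique_exists:
  assumes "m \<in> compatible_medians H X act"
  shows "\<exists>!M. median_extension G X \<iota> \<phi> m M"
proof -
  obtain M where "coordinatewise m M" using coordinatewise_exists[OF assms] by blast
  then show ?thesis
    using coordinatewise_extends[OF assms] extension_coordinatewise[OF assms] coordinatewise_unique
    by metis
qed

lemma orbit_of_base: "\<iota> ` orbit H act b1 = j ` carrier H"
proof -
  have "j h \<in> carrier G" if "h \<in> carrier H" for h
    using j_mon that by (auto simp: mon_def hom_def)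
  then have "\<iota> (act h b1) = j h" if "h \<in> carrier H" for h
    using that by (simp add: \<iota>_act base_in \<iota>_base)
  then show ?thesis by (force simp: orbit_def)
qed

end


section \<open>Words and their multiplication\<close>

text \<open>
  A pair \<open>(b, x)\<close> is a step that enters a copy of \<open>X\<close> at its point \<open>b\<close> and leaves it at \<open>x\<close>, and a
  list of pairs is a path. The point at which a path leaves the copy entered at \<open>c\<close> is \<open>c\<close> itself
  if the path does not begin in that copy; likewise \<open>glue\<close> omits a step that does not move.
\<close>

fun gate :: "'x \<Rightarrow> ('x \<times> 'x) list \<Rightarrow> 'x" where
  "gate c [] = c"
| "gate c ((b, x) # w) = (if b = c then x else c)"

fun beyond :: "'x \<Rightarrow> ('x \<times> 'x) list \<Rightarrow> ('x \<times> 'x) list" where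
  "beyond c [] = []"
| "beyond c ((b, x) # w) = (if b = c then w else (b, x) # w)"

fun starts :: "'x \<Rightarrow> ('x \<times> 'x) list \<Rightarrow> bool" where
  "starts c [] \<longleftrightarrow> False"
| "starts c ((b, x) # w) \<longleftrightarrow> b = c"

definition glue :: "'x \<Rightarrow> 'x \<Rightarrow> ('x \<times> 'x) list \<Rightarrow> ('x \<times> 'x) list" where
  "glue c x w = (if x = c then w else (c, x) # w)"

lemma gate_not_starts: "\<not> starts c w \<Longrightarrow> gate c w = c"
  by (cases w) auto

lemma beyond_not_starts: "\<not> starts c w \<Longrightarrow> beyond c w = w"
  by (cases w) auto

lemma starts_glue: "starts a (glue c x w) \<longleftrightarrow> (if x = c then starts a w else a = c)"
  by (auto simp: glue_def)

lemma gate_glue_other: "a \<noteq> c \<Longrightarrow> gate a (glue c x w) = (if x = c then gate a w else a)"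
  by (auto simp: glue_def)

context pointed_free_action
begin

text \<open>
  As a group element, the path \<open>[(c\<^sub>1, x\<^sub>1), \<dots>, (c\<^sub>n, x\<^sub>n)]\<close> stands for the product of the
  elements \<open>c\<^sub>i\<inverse> x\<^sub>i\<close>: from the current position \<open>u\<close> it enters the translate \<open>u c\<^sub>i\<inverse> X\<close>, of
  which \<open>u\<close> is the point \<open>c\<^sub>i\<close>, and moves to the point \<open>x\<^sub>i\<close> of that translate. As \<open>h X = X\<close> for
  \<open>h\<close> in \<open>H\<close>, every translate through \<open>u\<close> is described by exactly one orbit representative
  \<open>c\<^sub>i\<close>. A path is reduced if each step moves and none re-enters the translate just left.
\<close>

fun reduced :: "('x \<times> 'x) list \<Rightarrow> bool" where
  "reduced [] \<longleftrightarrow> True"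
| "reduced ((b, x) # w) \<longleftrightarrow>
     b \<in> X \<and> rep b = b \<and> x \<in> X \<and> x \<noteq> b \<and> \<not> starts (rep x) w \<and> reduced w"

text \<open>
  Left multiplication by \<open>b\<inverse> h c\<close>, where \<open>y = h c\<close> with \<open>c\<close> an orbit representative: write the
  argument as \<open>c\<inverse> x v\<close>, cancel \<open>c c\<inverse>\<close>, and obtain \<open>b\<inverse> (h x) v\<close>.
\<close>

definition letter_mul :: "'x \<Rightarrow> 'x \<Rightarrow> ('x \<times> 'x) list \<Rightarrow> ('x \<times> 'x) list" where
  "letter_mul b y w = glue b (act (coord y) (gate (rep y) w)) (beyond (rep y) w)"

fun word_mul :: "('x \<times> 'x) list \<Rightarrow> ('x \<times> 'x) list \<Rightarrow> ('x \<times> 'x) list" where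
  "word_mul [] v = v"
| "word_mul ((b, y) # u) v = letter_mul b y (word_mul u v)"

text \<open>
  Seen from the translate entered at \<open>c\<close>, a reduced word is its exit point followed by a word
  that leaves that translate for good; every such pair occurs.
\<close>

lemma reduced_decompose:
  assumes "reduced w" "c \<in> X" "rep c = c"
  shows "glue c (gate c w) (beyond c w) = w" "gate c w \<in> X" "reduced (beyond c w)"
    "\<not> starts (rep (gate c w)) (beyond c w)"
proof -
  have "glue c (gate c w) (beyond c w) = w \<and> gate c w \<in> X \<and> reduced (beyond c w) \<and>
    \<not> starts (rep (gate c w)) (beyond c w)"
  proof (cases w)
    case (Cons s v)
    obtain b x where "s = (b, x)" by (cases s)
    then show ?thesis using assms Cons by (auto simp: glue_def)
  qed (use assms in \<open>simp add: glue_def\<close>)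
  then show "glue c (gate c w) (beyond c w) = w" "gate c w \<in> X" "reduced (beyond c w)"
    "\<not> starts (rep (gate c w)) (beyond c w)" by blast+
qed

lemma glue_decompose:
  assumes "reduced w" "\<not> starts (rep x) w" "c \<in> X" "rep c = c" "x \<in> X"
  shows "reduced (glue c x w)" "gate c (glue c x w) = x" "beyond c (glue c x w) = w"
  using assms by (auto simp: glue_def gate_not_starts beyond_not_starts)

lemma reduced_letter_mul:
  assumes "reduced w" "b \<in> X" "rep b = b" "y \<in> X"
  shows "reduced (letter_mul b y w)"
  unfolding letter_mul_def
  using reduced_decompose[OF assms(1), of "rep y"] assms by (intro glue_decompose(1)) simp_all

lemma letter_mul_glue:
  assumes "reduced w" "\<not> starts (rep x) w" "x \<in> X" "y \<in> X"
  shows "letter_mul b y (glue (rep y) x w) = glue b (act (coord y) x) w"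
  using glue_decompose[OF assms(1,2) _ _ assms(3), of "rep y"] assms(4) by (simp add: letter_mul_def)

lemma letter_mul_self:
  assumes "reduced w" "b \<in> X" "rep b = b"
  shows "letter_mul b b w = w"
  using reduced_decompose[OF assms] assms by (simp add: letter_mul_def)

text \<open>The identity \<open>(a\<inverse> h c) (c\<inverse> x) = a\<inverse> (h x)\<close>, where \<open>y = h c\<close>.\<close>

lemma letter_mul_letter_mul:
  assumes "reduced w" "x \<in> X" "y \<in> X"
  shows "letter_mul a y (letter_mul (rep y) x w) = letter_mul a (act (coord y) x) w"
proof -
  note d = reduced_decompose[OF assms(1), of "rep x"]
  have "letter_mul a y (letter_mul (rep y) x w) =
      glue a (act (coord y) (act (coord x) (gate (rep x) w))) (beyond (rep x) w)"
    unfolding letter_mul_def[of "rep y"] using d assms by (intro letter_mul_glue) simp_all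
  then show ?thesis using d assms by (simp add: letter_mul_def act_mult)
qed

lemma reduced_word_mul: "reduced u \<Longrightarrow> reduced v \<Longrightarrow> reduced (word_mul u v)"
  by (induction u v rule: word_mul.induct) (simp_all add: reduced_letter_mul)

lemma word_mul_glue:
  assumes "reduced w" "reduced v" "c \<in> X" "rep c = c"
  shows "word_mul (glue c x w) v = letter_mul c x (word_mul w v)"
  using assms by (simp add: glue_def letter_mul_self reduced_word_mul)

lemma letter_mul_eq_Cons:
  assumes "reduced ((b, y) # u)" shows "letter_mul b y u = (b, y) # u"
  using assms by (simp add: letter_mul_def gate_not_starts beyond_not_starts glue_def)

text \<open>
  Associativity for a single letter; splitting \<open>w\<close> at the translate entered at \<open>rep y\<close> absorbs
  all cancellations between the letter and \<open>w\<close> at once.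
\<close>

lemma word_mul_letter_mul:
  assumes "reduced w" "reduced v" "a \<in> X" "rep a = a" "y \<in> X"
  shows "word_mul (letter_mul a y w) v = letter_mul a y (word_mul w v)"
proof -
  let ?x = "gate (rep y) w" and ?w = "beyond (rep y) w"
  note d = reduced_decompose[OF assms(1), of "rep y"]
  have "word_mul (letter_mul a y w) v = letter_mul a (act (coord y) ?x) (word_mul ?w v)"
    unfolding letter_mul_def[of a y w] using d assms by (intro word_mul_glue) simp_all
  also have "\<dots> = letter_mul a y (letter_mul (rep y) ?x (word_mul ?w v))"
    using d assms reduced_word_mul by (simp add: letter_mul_letter_mul)
  also have "letter_mul (rep y) ?x (word_mul ?w v) = word_mul w v"
    using word_mul_glue[of ?w v "rep y" ?x] d assms by simp
  finally show ?thesis .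
qed

lemma word_mul_assoc:
  assumes "reduced u" "reduced v" "reduced w"
  shows "word_mul (word_mul u v) w = word_mul u (word_mul v w)"
  using assms by (induction u) (auto simp: word_mul_letter_mul reduced_word_mul)

lemma word_mul_Nil: "reduced u \<Longrightarrow> word_mul u [] = u"
proof (induction u)
  case (Cons s u)
  then show ?case using letter_mul_eq_Cons by (cases s) auto
qed simp

text \<open>The inverse of the letter \<open>b\<inverse> h c\<close> is \<open>c\<inverse> h\<inverse> b\<close>.\<close>

lemma word_left_inverse: "reduced u \<Longrightarrow> \<exists>v. reduced v \<and> word_mul v u = []"
proof (induction u)
  case Nil
  show ?case by (rule exI[of _ "[]"]) simp
next
  case (Cons s u)
  obtain b y where s: "s = (b, y)" by (cases s)
  with Cons obtain v where v: "reduced v" "word_mul v u = []" by auto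
  have b: "b \<in> X" "rep b = b" "y \<in> X" and u: "reduced u" using Cons.prems s by auto
  let ?z = "act (inv\<^bsub>H\<^esub> (coord y)) b"
  let ?t = "glue (rep y) ?z []"
  have su: "s # u = letter_mul b y u" using Cons.prems s letter_mul_eq_Cons by simp
  have "word_mul ?t (s # u) = letter_mul (rep y) ?z (s # u)"
    using Cons.prems s b by (subst word_mul_glue) simp_all
  also have "\<dots> = letter_mul (rep y) ?z (letter_mul b y u)" by (simp only: su)
  also have "letter_mul (rep y) ?z (letter_mul b y u) = letter_mul (rep y) (act (coord ?z) y) u"
    using letter_mul_letter_mul[OF u, of y ?z "rep y"] b by simp
  also have "act (coord ?z) y = rep y"
    using b act_inv(1)[of "coord y" "rep y"] by simp
  also have "letter_mul (rep y) (rep y) u = u" using u b by (intro letter_mul_self) simp_all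
  finally have "word_mul (word_mul v ?t) (s # u) = []"
    using v b Cons.prems by (subst word_mul_assoc) (auto intro!: glue_decompose(1))
  moreover have "reduced (word_mul v ?t)"
    using v b by (auto intro!: glue_decompose(1) reduced_word_mul)
  ultimately show ?case by blast
qed

definition words :: "('x \<times> 'x) list monoid" where
  "words = \<lparr>carrier = {w. reduced w}, mult = word_mul, one = []\<rparr>"

lemma words_simps [simp]:
  "u \<in> carrier words \<longleftrightarrow> reduced u" "mult words = word_mul" "\<one>\<^bsub>words\<^esub> = []"
  by (simp_all add: words_def)

sublocale words: group words
  by (rule groupI) (simp_all add: reduced_word_mul word_mul_assoc word_left_inverse Bex_def)

definition embed :: "'x \<Rightarrow> ('x \<times> 'x) list" where
  "embed x = glue b1 x []"

lemma reduced_embed [simp]: "x \<in> X \<Longrightarrow> reduced (embed x)"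
  unfolding embed_def using base_in by (intro glue_decompose(1)) simp_all

lemma gate_embed [simp]: "x \<in> X \<Longrightarrow> gate b1 (embed x) = x"
  unfolding embed_def using base_in by (intro glue_decompose(2)) simp_all

lemma word_mul_embed:
  assumes "x \<in> X" "reduced w" shows "word_mul (embed x) w = letter_mul b1 x w"
  using assms base_in by (simp add: embed_def word_mul_glue)

text \<open>The letter \<open>b\<inverse> y\<close> is a quotient of two points of \<open>X\<close>.\<close>

lemma words_generated: "carrier words \<subseteq> generate words (embed ` X)"
proof
  fix u assume "u \<in> carrier words"
  then show "u \<in> generate words (embed ` X)"
  proof (induction u)
    case Nil
    show ?case using generate.one[of words "embed ` X"] by simp
  next
    case (Cons s u)
    obtain b y where s: "s = (b, y)" by (cases s)
    with Cons have b: "b \<in> X" "rep b = b" "y \<in> X" and u: "reduced u"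
      and IH: "u \<in> generate words (embed ` X)" by auto
    have r: "reduced (letter_mul b y [])" using b reduced_letter_mul by simp
    have "word_mul (embed b) (letter_mul b y []) = embed y"
      using word_mul_embed[OF b(1) r] letter_mul_letter_mul[of "[]" y b b1] b
        word_mul_embed[of y "[]"] by (simp add: word_mul_Nil)
    then have "letter_mul b y [] = word_mul (inv\<^bsub>words\<^esub> (embed b)) (embed y)"
      using words.inv_solve_left[of "letter_mul b y []" "embed b" "embed y"] r b by simp
    moreover have "word_mul (letter_mul b y []) u = s # u"
      using word_mul_letter_mul[of "[]" u b y] letter_mul_eq_Cons Cons.prems s b u by simp
    moreover have "word_mul (inv\<^bsub>words\<^esub> (embed b)) (embed y) \<in> generate words (embed ` X)"
      using generate.eng[OF generate.inv generate.incl, of "embed b" "embed ` X" "embed y" words] b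
      by simp
    ultimately show ?case using generate.eng[OF _ IH, of "letter_mul b y []"] by simp
  qed
qed


section \<open>The projections to the translates of \<open>X\<close>\<close>

text \<open>
  \<open>proj u a w\<close> is the gate of \<open>w\<close> in the translate that is reached from the origin along the
  path \<open>u\<close> and then entered at \<open>a\<close>: every word that does not begin with \<open>u\<close> branches off
  earlier and has the same gate \<open>a\<close> as the origin.
\<close>

fun proj :: "('x \<times> 'x) list \<Rightarrow> 'x \<Rightarrow> ('x \<times> 'x) list \<Rightarrow> 'x" where
  "proj [] a w = gate a w"
| "proj (s # u) a [] = proj u a []"
| "proj (s # u) a (t # w) = (if s = t then proj u a w else proj u a [])"

fun path_to :: "('x \<times> 'x) list \<Rightarrow> 'x \<Rightarrow> bool" where
  "path_to [] a \<longleftrightarrow> a \<in> X \<and> rep a = a"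
| "path_to ((b, x) # u) a \<longleftrightarrow>
     b \<in> X \<and> rep b = b \<and> x \<in> X \<and> x \<noteq> b \<and> \<not> starts (rep x) (u @ [(a, a)]) \<and> path_to u a"

lemma path_to_end: "path_to u a \<Longrightarrow> a \<in> X \<and> rep a = a"
  by (induction u a rule: path_to.induct) auto

lemma proj_Nil [simp]: "proj u a [] = a"
  by (induction u) auto

lemma proj_Cons:
  "proj (s # u) a w = (case w of [] \<Rightarrow> a | t # v \<Rightarrow> if s = t then proj u a v else a)"
  by (cases w) auto

lemma proj_closed: "path_to u a \<Longrightarrow> reduced w \<Longrightarrow> proj u a w \<in> X"
proof (induction u a w rule: proj.induct)
  case (1 a w)
  then show ?case using reduced_decompose(2) by simp
next
  case (2 s u a)
  then show ?case using path_to_end by simp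
next
  case (3 s u a t w)
  then show ?case using path_to_end[of "s # u" a] by (cases s; cases t) auto
qed

lemma proj_not_starts: "\<not> starts c w \<Longrightarrow> starts c (u @ [(a, a)]) \<Longrightarrow> proj u a w = a"
  by (cases u; cases w) (auto simp: gate_not_starts)

lemma proj_starts_other: "starts c w \<Longrightarrow> \<not> starts c (u @ [(a, a)]) \<Longrightarrow> proj u a w = a"
  by (cases u; cases w) (auto simp: gate_not_starts)

text \<open>
  Left multiplication moves translates to translates, so it turns projections into projections,
  up to the element of \<open>H\<close> by which the chosen coordinates on the two translates differ. The
  path to the new translate starts with the inverse letter, unless that letter cancels.
\<close>

lemma proj_letter_mul:
  assumes u: "path_to u a" and b: "b \<in> X" "rep b = b" and y: "y \<in> X"
  shows "\<exists>h\<in>carrier H. \<exists>u' a'. path_to u' a' \<and>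
    (\<forall>w. reduced w \<longrightarrow> proj u a (letter_mul b y w) = act h (proj u' a' w))"
proof -
  define c where "c = rep y"
  define h where "h = coord y"
  define g where "g = inv\<^bsub>H\<^esub> h"
  have c: "c \<in> X" "rep c = c" and h: "h \<in> carrier H" "g \<in> carrier H"
    using y by (simp_all add: c_def h_def g_def)
  have hg: "act h x = z \<longleftrightarrow> x = act g z" if "x \<in> X" "z \<in> X" for x z
    using that h(1) unfolding g_def by (metis act_inv)
  have lm: "letter_mul b y w = glue b (act h (gate c w)) (beyond c w)" for w
    by (simp add: letter_mul_def c_def h_def)
  note d = reduced_decompose[OF _ c]
  have keep: ?thesis
    if "path_to u' a'" "\<And>w. reduced w \<Longrightarrow> proj u a (letter_mul b y w) = proj u' a' w" for u' a'
    using that proj_closed[OF that(1)]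
    by (intro bexI[of _ "\<one>\<^bsub>H\<^esub>"] exI[of _ u'] exI[of _ a']) auto
  have step: "path_to ((c, act g z) # u') a'"
    if "path_to u' a'" "z \<in> X" "\<not> starts (rep z) (u' @ [(a', a')])" "act g z \<noteq> c" for u' a' z
    using that c h by simp
  \<comment> \<open>On the first step of a path, \<open>proj\<close> tests the gate in the translate entered at \<open>c\<close>.\<close>
  have head: "(w = (c, x) # beyond c w) \<longleftrightarrow> gate c w = x" if "reduced w" "x \<noteq> c" for w x
    using d(1)[OF that(1)] that(2) by (cases w) (auto split: if_splits)
  have cons: "proj ((c, x) # u') a' w = (if gate c w = x then proj u' a' (beyond c w) else a')"
    if "reduced w" "x \<noteq> c" for w x u' a'
    using head[OF that] that by (cases w) (auto simp: proj_Cons split: if_splits)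
  show ?thesis
  proof (cases "starts b (u @ [(a, a)])")
    case False
    \<comment> \<open>The letter does not touch the path \<open>u\<close>, so the inverse letter is prepended to \<open>u\<close>. It is
      not a step if \<open>act g b = c\<close>, but then the letter is trivial.\<close>
    show ?thesis
    proof (cases "act g b = c")
      case True
      then have "b = c" using h b c rep_act[of g b] by metis
      then have "act g b = b" using True by simp
      then have "g = \<one>\<^bsub>H\<^esub>" using act_free[of g "\<one>\<^bsub>H\<^esub>" b] h b by simp
      then have "h = \<one>\<^bsub>H\<^esub>" using h unfolding g_def by (metis H.inv_inv H.inv_one coord_closed h_def y)
      then have "letter_mul b y w = w" if "reduced w" for w
        using lm[of w] that d[OF that] \<open>b = c\<close> by simp
      then show ?thesis using keep[OF u] by simp
    next
      case gb: False
      have "proj u a (letter_mul b y w) = proj ((c, act g b) # u) a w" if w: "reduced w" for w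
      proof (cases "gate c w = act g b")
        case True
        then show ?thesis using cons[OF w gb] d(2)[OF w] hg b by (simp add: lm glue_def)
      next
        case ne: False
        then have "starts b (letter_mul b y w)"
          using hg d(2)[OF w] b by (simp add: lm glue_def)
        then show ?thesis using proj_starts_other False cons[OF w gb] ne by simp
      qed
      then show ?thesis using keep[OF step[OF u b(1) _ gb]] b False by simp
    qed
  next
    case True
    \<comment> \<open>The letter and \<open>u\<close> meet in the same translate. If \<open>u\<close> is empty, that translate is the target
      and \<open>H\<close> moves the gate; otherwise the two steps merge, or cancel if \<open>act g z = c\<close>.\<close>
    show ?thesis
    proof (cases u)
      case Nil
      then have "a = b" using True by simp
      then have "proj u a (letter_mul b y w) = act h (proj [] c w)" if "reduced w" for w
        using Nil d[OF that] b h glue_decompose(2)[of "beyond c w" "act h (gate c w)" b]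
        by (simp add: lm)
      then show ?thesis using h c by (intro bexI[of _ h] exI[of _ "[]"] exI[of _ c]) auto
    next
      case (Cons s v)
      then obtain z where s: "s = (b, z)" using True by (cases s) auto
      have v: "path_to v a" "z \<in> X" "z \<noteq> b" "\<not> starts (rep z) (v @ [(a, a)])"
        using u Cons s by auto
      have red: "proj u a (letter_mul b y w) = (if gate c w = act g z then proj v a (beyond c w) else a)"
        if w: "reduced w" for w
      proof -
        have 1: "act h (gate c w) = z \<longleftrightarrow> gate c w = act g z" using hg d(2)[OF w] v(2) by blast
        have 2: "proj u a (beyond c w) = a" if "act h (gate c w) = b"
        proof (rule proj_not_starts[OF _ True])
          have "rep (gate c w) = b" using that rep_act[OF h(1) d(2)[OF w]] b by simp
          then show "\<not> starts b (beyond c w)" using d(4)[OF w] by simp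
        qed
        show ?thesis using 1 2 v(3) Cons s by (auto simp: lm glue_def)
      qed
      show ?thesis
      proof (cases "act g z = c")
        case False
        then show ?thesis using keep[OF step[OF v(1,2,4) False]] red cons by simp
      next
        case gz: True
        then have "rep z = c" using rep_act[OF h(2) v(2)] c by simp
        have "proj u a (letter_mul b y w) = proj v a w" if w: "reduced w" for w
        proof (cases "starts c w")
          case True
          then have "gate c w \<noteq> c" using w by (cases w) auto
          then show ?thesis
            using red[OF w] gz proj_starts_other[OF True] v(4) \<open>rep z = c\<close> by simp
        next
          case False
          then show ?thesis using red[OF w] gz by (simp add: gate_not_starts beyond_not_starts)
        qed
        then show ?thesis using keep[OF v(1)] by simp
      qed
    qed
  qed
qed

lemma proj_word_mul:
  assumes "reduced k" "path_to u a"
  shows "\<exists>h\<in>carrier H. \<exists>u' a'. path_to u' a' \<and>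
    (\<forall>w. reduced w \<longrightarrow> proj u a (word_mul k w) = act h (proj u' a' w))"
  using assms
proof (induction k arbitrary: u a)
  case Nil
  then show ?case using proj_closed[OF Nil(2)] by (intro bexI[of _ "\<one>\<^bsub>H\<^esub>"] exI[of _ u] exI[of _ a]) auto
next
  case (Cons s k)
  obtain b y where s: "s = (b, y)" by (cases s)
  have b: "b \<in> X" "rep b = b" "y \<in> X" and k: "reduced k" using Cons.prems(1) s by auto
  obtain h u1 a1 where 1: "h \<in> carrier H" "path_to u1 a1"
      "\<And>w. reduced w \<Longrightarrow> proj u a (letter_mul b y w) = act h (proj u1 a1 w)"
    using proj_letter_mul[OF Cons.prems(2) b] by blast
  obtain h' u2 a2 where 2: "h' \<in> carrier H" "path_to u2 a2"
      "\<And>w. reduced w \<Longrightarrow> proj u1 a1 (word_mul k w) = act h' (proj u2 a2 w)"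
    using Cons.IH[OF k 1(2)] by blast
  have "proj u a (word_mul (s # k) w) = act (h \<otimes>\<^bsub>H\<^esub> h') (proj u2 a2 w)" if w: "reduced w" for w
    using 1 2 w s k proj_closed[OF 2(2) w] by (simp add: reduced_word_mul act_mult)
  then show ?case using 1 2 by (intro bexI[of _ "h \<otimes>\<^bsub>H\<^esub> h'"]) auto
qed

text \<open>The point of \<open>X\<close> at which a path from the base point leaves \<open>X\<close>.\<close>

abbreviation fold_base :: "('x \<times> 'x) list \<Rightarrow> 'x" where
  "fold_base \<equiv> gate b1"

lemma coordinate_is_proj:
  assumes "reduced k"
  obtains h u a where "h \<in> carrier H" "path_to u a"
    "\<And>w. reduced w \<Longrightarrow> fold_base (word_mul k w) = act h (proj u a w)"
proof -
  have "path_to [] b1" using base_in by simp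
  from proj_word_mul[OF assms this] show thesis using that by auto
qed

text \<open>
  Multiplication by the point \<open>c\<close> of \<open>X\<close> makes \<open>gate c\<close> a coordinate. These coordinates detect
  the first letter of a word; cancelling a common first letter reduces to shorter words.
\<close>

lemma fold_base_embed_mul:
  assumes "reduced w" "y \<in> X" shows "fold_base (word_mul (embed y) w) = act (coord y) (gate (rep y) w)"
  using assms reduced_decompose[OF assms(1), of "rep y"] base_in
    glue_decompose(2)[of "beyond (rep y) w" "act (coord y) (gate (rep y) w)" b1]
  by (simp add: word_mul_embed letter_mul_def)

lemma words_separation:
  assumes "reduced u" "reduced v"
    and "\<And>k. reduced k \<Longrightarrow> fold_base (word_mul k u) = fold_base (word_mul k v)"
  shows "u = v"
  using assms
proof (induction u arbitrary: v)
  case Nil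
  have "gate c [] = gate c v" if c: "c \<in> X" "rep c = c" for c
    using Nil(3)[OF reduced_embed[OF c(1)]] c
      fold_base_embed_mul[OF Nil(1) c(1)] fold_base_embed_mul[OF Nil(2) c(1)]
      reduced_decompose(2)[OF Nil(1) c] reduced_decompose(2)[OF Nil(2) c] by simp
  then show ?case using Nil(2) by (cases v) force+
next
  case (Cons s u)
  obtain b x where s: "s = (b, x)" by (cases s)
  have b: "b \<in> X" "rep b = b" "x \<in> X" "x \<noteq> b" and u: "reduced u" using Cons.prems(1) s by auto
  have "gate b (s # u) = gate b v"
    using Cons.prems(3)[of "embed b"] b Cons.prems(1,2) reduced_decompose(2)
    by (simp add: fold_base_embed_mul)
  then obtain v' where v: "v = s # v'" using s b by (cases v) (auto split: if_splits)
  then have v': "reduced v'" using Cons.prems(2) s by simp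
  have s1: "reduced [s]" "\<And>w. reduced (s # w) \<Longrightarrow> word_mul [s] w = s # w"
    using b s by (simp_all add: letter_mul_eq_Cons)
  obtain t where t: "reduced t" "word_mul t [s] = []" using word_left_inverse[OF s1(1)] by blast
  \<comment> \<open>Left multiplication by \<open>t\<close> permutes the coordinates and removes the common first step.\<close>
  have cancel: "word_mul t (s # w) = w" if "reduced (s # w)" for w
  proof -
    have w: "reduced w" using that s by simp
    have "word_mul t (word_mul [s] w) = w"
      using word_mul_assoc[OF t(1) s1(1) w] t by simp
    then show ?thesis using s1(2)[OF that] by simp
  qed
  have "fold_base (word_mul k u) = fold_base (word_mul k v')" if k: "reduced k" for k
    using Cons.prems(3)[OF reduced_word_mul[OF k t(1)]] Cons.prems(1,2) v k t
    by (simp add: word_mul_assoc cancel del: word_mul.simps)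
  then show ?case using Cons.IH[OF u v'] v by simp
qed

text \<open>
  Among the projections only the one to \<open>X\<close> itself, with the empty path and entry point \<open>b1\<close>,
  distinguishes points of \<open>X\<close>.
\<close>

lemma words_shadow:
  assumes "reduced k"
  shows "(\<exists>h\<in>carrier H. \<forall>w. reduced w \<longrightarrow> fold_base (word_mul k w) = act h (fold_base w)) \<or>
    (\<exists>c. \<forall>x\<in>X. fold_base (word_mul k (embed x)) = c)"
proof -
  obtain h u a where *: "h \<in> carrier H" "path_to u a"
    "\<And>w. reduced w \<Longrightarrow> fold_base (word_mul k w) = act h (proj u a w)"
    using coordinate_is_proj[OF assms] by blast
  show ?thesis
  proof (cases "u = [] \<and> a = b1")
    case True
    then show ?thesis using * by auto
  next
    case False
    have "\<exists>c. \<forall>x\<in>X. proj u a (embed x) = c"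
    proof (cases u)
      case Nil
      then show ?thesis using False by (auto simp: embed_def gate_glue_other)
    next
      case (Cons s v)
      then have "proj u a (embed x) = a" for x
        by (auto simp: embed_def glue_def)
      then show ?thesis by blast
    qed
    then show ?thesis using *(3) by (metis reduced_embed)
  qed
qed


section \<open>The median of two words and the origin\<close>

text \<open>
  The paths from the origin to two points have a common initial part. They separate either
  outside all translates, or inside one translate entered at \<open>b\<close> and left at two different
  points; in the latter case the median in \<open>X\<close> of these three points is the answer.
\<close>

fun prefix_median :: "('x \<times> 'x \<times> 'x \<Rightarrow> 'x) \<Rightarrow> ('x \<times> 'x) list \<Rightarrow> ('x \<times> 'x) list \<Rightarrow> ('x \<times> 'x) list"
where
  "prefix_median m ((b, p) # x) ((c, q) # y) =
     (if b = c then if p = q then (b, p) # prefix_median m x y else glue b (m (b, p, q)) [] else [])"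
| "prefix_median m _ _ = []"

lemma prefix_median_Nil [simp]: "prefix_median m [] y = []" "prefix_median m x [] = []"
  by (cases x; simp)+

lemma starts_prefix_median: "starts c (prefix_median m x y) \<Longrightarrow> starts c x"
proof -
  have "starts c x" if "starts c (prefix_median m ((b, p) # x') ((d, q) # y'))" "x = (b, p) # x'"
    for b p x' d q y' using that by (auto simp: starts_glue split: if_splits)
  then show "starts c (prefix_median m x y) \<Longrightarrow> starts c x"
    by (cases x; cases y) auto
qed

lemma reduced_prefix_median:
  assumes m: "median_op X m" and "reduced x" "reduced y"
  shows "reduced (prefix_median m x y)"
  using assms(2,3)
proof (induction x arbitrary: y)
  case (Cons s x)
  show ?case
  proof (cases y)
    case (Cons t v)
    obtain b p c q where st: "s = (b, p)" "t = (c, q)" by (cases s, cases t)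
    have b: "b \<in> X" "rep b = b" "p \<in> X" "\<not> starts (rep p) x" "q \<in> X" "reduced x" "reduced v"
      using Cons.prems Cons st by auto
    have "reduced (prefix_median m x v)" using Cons.IH b by blast
    moreover have "\<not> starts (rep p) (prefix_median m x v)" using b starts_prefix_median by blast
    moreover have "reduced (glue b (m (b, p, q)) [])"
      using b median_op_closed[OF m] by (intro glue_decompose(1)) simp_all
    ultimately show ?thesis using Cons.prems Cons st by auto
  qed simp
qed simp

text \<open>
  In a translate that does not contain the separation of the two paths, at least two of the
  three gates agree, and so does the gate of \<open>prefix_median m x y\<close>.
\<close>

lemma proj_prefix_median:
  assumes m: "median_op X m" and "path_to u a" "reduced x" "reduced y"
  shows "proj u a (prefix_median m x y) = m (a, proj u a x, proj u a y)"
  using assms(2-4)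
proof (induction x arbitrary: y u)
  case Nil
  have "a \<in> X" "proj u a y \<in> X" using Nil path_to_end proj_closed by blast+
  then show ?case using median_op_majority[OF m] by simp
next
  case (Cons s x)
  have a: "a \<in> X" "rep a = a" using Cons.prems path_to_end by blast+
  have gX: "proj u a w \<in> X" if "reduced w" for w using Cons.prems(1) that proj_closed by blast
  show ?case
  proof (cases y)
    case Nil
    then show ?thesis using gX[OF Cons.prems(2)] a median_op_majority[OF m] by simp
  next
    case y: (Cons t v)
    obtain b p c q where st: "s = (b, p)" "t = (c, q)" by (cases s, cases t)
    have b: "b \<in> X" "rep b = b" "p \<in> X" "p \<noteq> b" "\<not> starts (rep p) x" "q \<in> X" "q \<noteq> c" "c \<in> X"
        "reduced x" "reduced v"
      using Cons.prems y st by auto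
    have t: "m (b, p, q) \<in> X" using b median_op_closed[OF m] by blast
    show ?thesis
    proof (cases u)
      case Nil
      have "gate b (glue b (m (b, p, q)) []) = m (b, p, q)"
        using b t by (intro glue_decompose(2)) simp_all
      then show ?thesis
        using Nil y st a b median_op_majority[OF m] by (auto simp: gate_glue_other)
    next
      case u: (Cons r u')
      have u': "path_to u' a" using Cons.prems u by (cases r) simp
      have gX': "proj u' a w \<in> X" if "reduced w" for w using u' that proj_closed by blast
      show ?thesis
      proof (cases "s = t")
        case True
        then have "prefix_median m (s # x) y = s # prefix_median m x v" using st y by simp
        then show ?thesis
          using Cons.IH[OF u' b(9,10)] True u y a median_op_majority[OF m] by simp
      next
        case False
        then have "proj u a (prefix_median m (s # x) y) = a"
          using st y u by (auto simp: glue_def)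
        moreover have "proj u a (s # x) = a \<or> proj u a y = a" using False u y by auto
        ultimately show ?thesis
          using gX Cons.prems a median_op_majority[OF m] by metis
      qed
    qed
  qed
qed

lemma coordinate_prefix_median:
  assumes m: "m \<in> compatible_medians H X act" and "reduced x" "reduced y" and k: "reduced k"
  shows "fold_base (word_mul k (prefix_median m x y)) =
    m (fold_base k, fold_base (word_mul k x), fold_base (word_mul k y))"
proof -
  obtain h u a where *: "h \<in> carrier H" "path_to u a"
    "\<And>w. reduced w \<Longrightarrow> fold_base (word_mul k w) = act h (proj u a w)"
    using coordinate_is_proj[OF k] by blast
  note mX = compatible_median(1)[OF m]
  have "fold_base k = act h a" using *(3)[of "[]"] k by (simp add: word_mul_Nil)
  then show ?thesis
    using * assms(2,3) path_to_end[OF *(2)] proj_closed[OF *(2)]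
    by (simp add: reduced_prefix_median[OF mX] proj_prefix_median[OF mX] compatible_median(2)[OF m])
qed

text \<open>Left translation by the inverse of \<open>x\<close> moves any triple to one that contains the origin.\<close>

lemma words_coords_median:
  assumes m: "m \<in> compatible_medians H X act" and r: "reduced x" "reduced y" "reduced z"
  shows "\<exists>u. reduced u \<and> (\<forall>k. reduced k \<longrightarrow> fold_base (word_mul k u) =
    m (fold_base (word_mul k x), fold_base (word_mul k y), fold_base (word_mul k z)))"
proof -
  obtain x' where x': "reduced x'" "word_mul x' x = []" using word_left_inverse r by blast
  have inv: "word_mul x x' = []"
    using words.r_inv[of x] words.inv_equality[of x' x] x' r by simp
  let ?u = "prefix_median m (word_mul x' y) (word_mul x' z)"
  have u: "reduced ?u"
    using compatible_median(1)[OF m] x' r by (simp add: reduced_prefix_median reduced_word_mul)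
  have "fold_base (word_mul k (word_mul x ?u)) =
      m (fold_base (word_mul k x), fold_base (word_mul k y), fold_base (word_mul k z))"
    if k: "reduced k" for k
  proof -
    have "word_mul (word_mul k x) (word_mul x' w) = word_mul k w" if w: "reduced w" for w
    proof -
      have "word_mul x (word_mul x' w) = w" using word_mul_assoc[OF r(1) x'(1) w] inv by simp
      then show ?thesis using word_mul_assoc[OF k r(1)] reduced_word_mul[OF x'(1) w] by simp
    qed
    then show ?thesis
      using coordinate_prefix_median[OF m, of "word_mul x' y" "word_mul x' z" "word_mul k x"]
        k r x' u by (simp add: word_mul_assoc[OF k r(1) u] reduced_word_mul)
  qed
  then show ?thesis using u r reduced_word_mul by blast
qed

lemma coordinatewise_cell_of_words:
  assumes m: "m \<in> compatible_medians H X act" and "reduced y" "reduced z"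
  shows "(\<forall>k. reduced k \<longrightarrow> m (fold_base k, fold_base (word_mul k y), fold_base (word_mul k z)) =
    fold_base (word_mul k z)) \<longleftrightarrow> prefix_median m y z = z"
  using coordinate_prefix_median[OF m assms(2,3)] words_separation[of "prefix_median m y z" z]
    reduced_prefix_median[OF compatible_median(1)[OF m] assms(2,3)] assms(3) by metis

text \<open>
  The cell from the origin to \<open>y\<close> consists of the initial parts of the path \<open>y\<close>, the last
  letter of which may stop anywhere between the entry and the exit point of its translate.
\<close>

lemma prefix_cell_Cons:
  assumes m: "median_op X m" and "reduced ((b, p) # y)" "reduced z"
  shows "prefix_median m ((b, p) # y) z = z \<longleftrightarrow>
    (\<exists>t\<in>cell X m b p. z = glue b t []) \<or> (\<exists>z'. z = (b, p) # z' \<and> prefix_median m y z' = z')"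
proof (cases z)
  case Nil
  have b: "b \<in> X" "p \<in> X" using assms(2) by auto
  then have "b \<in> cell X m b p" using median_op_majority[OF m] by (simp add: cell_def)
  moreover have "z = glue b b []" using Nil by (simp add: glue_def)
  ultimately show ?thesis using Nil by auto
next
  case (Cons s v)
  obtain c q where s: "s = (c, q)" by (cases s)
  have b: "b \<in> X" "p \<in> X" and q: "q \<in> X" "q \<noteq> c" using assms(2,3) Cons s by auto
  have p: "p \<in> cell X m b p" using b median_op_majority[OF m] by (simp add: cell_def)
  show ?thesis
  proof (cases "c = b \<and> q = p")
    case True
    then show ?thesis using Cons s p by (auto simp: glue_def)
  next
    case False
    then show ?thesis using Cons s q by (auto simp: glue_def cell_def split: if_splits)
  qed
qed

text \<open>
  Two initial parts of a path are nested unless both stop inside the same translate, where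
  local linearity of \<open>X\<close> decides.
\<close>

lemma prefix_cells_comparable:
  assumes m: "median_op X m" and lin: "locally_linear X m"
    and "reduced y" "reduced z" "reduced w" "prefix_median m y z = z" "prefix_median m y w = w"
  shows "prefix_median m z w = w \<or> prefix_median m w z = z"
  using assms(3-)
proof (induction y arbitrary: z w)
  case (Cons s y)
  obtain b p where s: "s = (b, p)" by (cases s)
  note y = Cons.prems(1)[unfolded s]
  have b: "b \<in> X" "rep b = b" "p \<in> X" "p \<noteq> b" "reduced y" using y by auto
  note pc = prefix_cell_Cons[OF m]
  have trivial: "t = b" if "t \<in> cell X m b b" for t
    using that b(1) median_op_majority(1)[OF m] by (auto simp: cell_def)
  have start: "prefix_median m v (glue b t []) = glue b t []"
    if "reduced v" "t \<in> cell X m b (gate b v)" for t v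
  proof (cases v)
    case Nil
    then show ?thesis using that trivial by (simp add: glue_def)
  next
    case (Cons r v')
    obtain c q where r: "r = (c, q)" by (cases r)
    show ?thesis
    proof (cases "c = b")
      case True
      then show ?thesis using Cons r that by (auto simp: glue_def cell_def)
    next
      case False
      then show ?thesis using Cons r that trivial by (auto simp: glue_def)
    qed
  qed
  have gate: "gate b (glue b t []) = t" if "t \<in> cell X m b p" for t
    using that b by (intro glue_decompose(2)) (simp_all add: cell_def)
  consider (both) t t' where "t \<in> cell X m b p" "t' \<in> cell X m b p" "z = glue b t []" "w = glue b t' []"
    | (left) t w' where "t \<in> cell X m b p" "z = glue b t []" "w = (b, p) # w'"
    | (right) t z' where "t \<in> cell X m b p" "w = glue b t []" "z = (b, p) # z'"
    | (none) z' w' where "z = (b, p) # z'" "w = (b, p) # w'"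
        "prefix_median m y z' = z'" "prefix_median m y w' = w'"
    using pc[OF y Cons.prems(2)] pc[OF y Cons.prems(3)] Cons.prems(4,5) unfolding s by metis
  then show ?case
  proof cases
    case both
    have tX: "t \<in> X" using both(1) by (simp add: cell_def)
    have "t' \<in> cell X m b t \<or> t' \<in> cell X m t p"
      using lin b(1,3) both(1,2) unfolding locally_linear_def by blast
    \<comment> \<open>Seen from the other end \<open>p\<close>, the points \<open>t'\<close>, \<open>t\<close>, \<open>b\<close> occur in this order.\<close>
    moreover have "t \<in> cell X m b t'" if "t' \<in> cell X m t p"
    proof -
      have "t' \<in> X" using that by (simp add: cell_def)
      then show ?thesis
        using cell_complement[OF m b(3,1), of t t'] that both(1) cell_sym[OF m] tX b(1,3) by metis
    qed
    ultimately show ?thesis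
      using start[of z t'] start[of w t] gate[OF both(1)] gate[OF both(2)] both(3,4) Cons.prems(2,3)
      by metis
  next
    case left
    then show ?thesis using start[of w t] Cons.prems(3) by simp
  next
    case right
    then show ?thesis using start[of z t] Cons.prems(2) by simp
  next
    case none
    then show ?thesis using Cons.IH[of z' w'] b Cons.prems(2,3) by auto
  qed
qed simp

lemma prefix_cells_finite:
  assumes m: "median_op X m" and fin: "simplicial X m" and "reduced y"
  shows "finite {z. reduced z \<and> prefix_median m y z = z}"
  using assms(3)
proof (induction y)
  case (Cons s y)
  obtain b p where s: "s = (b, p)" by (cases s)
  note y = Cons.prems[unfolded s]
  have "finite (cell X m b p)" using fin y by (simp add: simplicial_def)
  moreover have "finite {z. reduced z \<and> prefix_median m y z = z}" using Cons.IH y by simp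
  moreover have "{z. reduced z \<and> prefix_median m (s # y) z = z} \<subseteq>
      (\<lambda>t. glue b t []) ` cell X m b p \<union> Cons (b, p) ` {z. reduced z \<and> prefix_median m y z = z}"
    unfolding s by (auto simp: prefix_cell_Cons[OF m y])
  ultimately show ?case by (meson finite_UnI finite_imageI finite_subset)
qed simp

definition act_word :: "'h \<Rightarrow> ('x \<times> 'x) list" where
  "act_word h = embed (act h b1)"

lemma reduced_act_word [simp]: "h \<in> carrier H \<Longrightarrow> reduced (act_word h)"
  using base_in by (simp add: act_word_def)

text \<open>
  As \<open>b1\<close> represents its own orbit, \<open>h\<close> moves only the point at which a path leaves \<open>X\<close>.
\<close>

lemma word_mul_act_word:
  assumes "h \<in> carrier H" "reduced w"
  shows "word_mul (act_word h) w = glue b1 (act h (gate b1 w)) (beyond b1 w)"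
  using assms base_in by (simp add: act_word_def word_mul_embed letter_mul_def)

lemma act_word_embed:
  assumes "h \<in> carrier H" "x \<in> X"
  shows "word_mul (act_word h) (embed x) = embed (act h x)"
  using assms glue_decompose(3)[of "[]" x b1] base_in
  by (simp add: word_mul_act_word embed_def[of "act h x"]) (simp add: embed_def)

lemma act_word_mon: "act_word \<in> mon H words"
proof -
  have "act_word \<in> hom H words"
    using act_word_embed base_in by (auto simp: hom_def act_word_def act_mult)
  moreover have "inj_on act_word (carrier H)"
  proof (rule inj_onI)
    fix h k assume hk: "h \<in> carrier H" "k \<in> carrier H" "act_word h = act_word k"
    then have "act h b1 = act k b1"
      using gate_embed base_in act_closed by (metis act_word_def)
    then show "h = k" using act_free hk base_in by blast
  qed
  ultimately show ?thesis by (simp add: mon_def)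
qed

lemma fold_base_act_word:
  assumes "h \<in> carrier H" "reduced w"
  shows "fold_base (word_mul (act_word h) w) = act h (fold_base w)"
proof -
  note d = reduced_decompose[OF assms(2) base_in rep_base]
  show ?thesis
    unfolding word_mul_act_word[OF assms]
    using d assms base_in by (intro glue_decompose(2)) simp_all
qed

lemma words_coordinate_group: "coordinate_group H X act b1 words act_word embed fold_base"
proof unfold_locales
  show "act_word \<in> mon H words" by (rule act_word_mon)
  show "carrier words \<subseteq> generate words (embed ` X)" by (rule words_generated)
  show "embed b1 = \<one>\<^bsub>words\<^esub>" by (simp add: embed_def glue_def)
next
  fix u assume "u \<in> carrier words"
  then show "fold_base u \<in> X" using reduced_decompose(2) base_in by simp
next
  fix u v assume "u \<in> carrier words" "v \<in> carrier words"
    "\<forall>k\<in>carrier words. fold_base (k \<otimes>\<^bsub>words\<^esub> u) = fold_base (k \<otimes>\<^bsub>words\<^esub> v)"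
  then show "u = v" using words_separation[of u v] by simp
next
  fix m y z w assume "m \<in> compatible_medians H X act"
    "y \<in> carrier words" "z \<in> carrier words" "w \<in> carrier words"
  then show "\<exists>u\<in>carrier words. \<forall>k\<in>carrier words. fold_base (k \<otimes>\<^bsub>words\<^esub> u) =
      m (fold_base (k \<otimes>\<^bsub>words\<^esub> y), fold_base (k \<otimes>\<^bsub>words\<^esub> z), fold_base (k \<otimes>\<^bsub>words\<^esub> w))"
    using words_coords_median[of m y z w] by (simp add: Bex_def Ball_def)
next
  fix k assume "k \<in> carrier words"
  then show "(\<exists>h\<in>carrier H. \<forall>u\<in>carrier words. fold_base (k \<otimes>\<^bsub>words\<^esub> u) = act h (fold_base u)) \<or>
      (\<exists>c. \<forall>x\<in>X. fold_base (k \<otimes>\<^bsub>words\<^esub> embed x) = c)"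
    using words_shadow[of k] by (simp add: Ball_def)
next
  fix m y z w assume m: "m \<in> compatible_medians H X act" and lin: "locally_linear X m"
    and r: "y \<in> carrier words" "z \<in> carrier words" "w \<in> carrier words"
    and zw: "\<forall>k\<in>carrier words. m (fold_base k, fold_base (k \<otimes>\<^bsub>words\<^esub> y), fold_base (k \<otimes>\<^bsub>words\<^esub> z)) =
        fold_base (k \<otimes>\<^bsub>words\<^esub> z)"
      "\<forall>k\<in>carrier words. m (fold_base k, fold_base (k \<otimes>\<^bsub>words\<^esub> y), fold_base (k \<otimes>\<^bsub>words\<^esub> w)) =
        fold_base (k \<otimes>\<^bsub>words\<^esub> w)"
  note cw = coordinatewise_cell_of_words[OF m]
  have r': "reduced y" "reduced z" "reduced w" using r by simp_all
  have "prefix_median m y z = z" "prefix_median m y w = w"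
    using zw cw[OF r'(1,2)] cw[OF r'(1,3)] by (simp_all add: Ball_def)
  then have "prefix_median m z w = w \<or> prefix_median m w z = z"
    by (rule prefix_cells_comparable[OF compatible_median(1)[OF m] lin r'])
  then show "(\<forall>k\<in>carrier words. m (fold_base k, fold_base (k \<otimes>\<^bsub>words\<^esub> z), fold_base (k \<otimes>\<^bsub>words\<^esub> w)) =
        fold_base (k \<otimes>\<^bsub>words\<^esub> w)) \<or>
      (\<forall>k\<in>carrier words. m (fold_base k, fold_base (k \<otimes>\<^bsub>words\<^esub> w), fold_base (k \<otimes>\<^bsub>words\<^esub> z)) =
        fold_base (k \<otimes>\<^bsub>words\<^esub> z))"
    using cw[OF r'(2,3)] cw[OF r'(3,2)] by (simp add: Ball_def)
next
  fix m y assume m: "m \<in> compatible_medians H X act" and fin: "simplicial X m"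
    and "y \<in> carrier words"
  then have y: "reduced y" by simp
  have "{z \<in> carrier words. \<forall>k\<in>carrier words.
      m (fold_base k, fold_base (k \<otimes>\<^bsub>words\<^esub> y), fold_base (k \<otimes>\<^bsub>words\<^esub> z)) = fold_base (k \<otimes>\<^bsub>words\<^esub> z)} =
      {z. reduced z \<and> prefix_median m y z = z}"
    using coordinatewise_cell_of_words[OF m y] by (auto simp: Ball_def)
  then show "finite {z \<in> carrier words. \<forall>k\<in>carrier words.
      m (fold_base k, fold_base (k \<otimes>\<^bsub>words\<^esub> y), fold_base (k \<otimes>\<^bsub>words\<^esub> z)) = fold_base (k \<otimes>\<^bsub>words\<^esub> z)}"
    using prefix_cells_finite[OF compatible_median(1)[OF m] fin y] by simp
qed (simp_all add: act_word_embed fold_base_act_word)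

end


section \<open>Encoding words in the ambient type\<close>

text \<open>
  The definition is invariant under isomorphism, so it can be checked on the lists of pairs and
  then moved along any injection of their type.
\<close>

lemma (in coordinate_group) coordinate_group_image:
  assumes f: "inj_on f (carrier G)"
  shows "coordinate_group H X act b1 (image_group f G) (f \<circ> j) (f \<circ> \<iota>) (\<phi> \<circ> inv_into (carrier G) f)"
proof -
  let ?G = "image_group f G" and ?p = "\<phi> \<circ> inv_into (carrier G) f"
  interpret G': group ?G by (rule inj_imp_image_group_is_group[OF f])
  have iso: "f \<in> iso G ?G" by (rule inj_imp_image_group_iso[OF f])
  interpret f: group_hom G ?G f using iso by unfold_locales (simp add: iso_def)
  have C: "carrier ?G = f ` carrier G" by (rule image_group_carrier)
  have mul: "f u \<otimes>\<^bsub>?G\<^esub> f v = f (u \<otimes> v)" if "u \<in> carrier G" "v \<in> carrier G" for u v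
    using that by simp
  note f.hom_mult [simp del]
  have jC: "j h \<in> carrier G" if "h \<in> carrier H" for h
    using j_mon that by (auto simp: mon_def hom_def)
  note inv = inv_into_f_f[OF f]
  note eq = inj_on_eq_iff[OF f]
  show ?thesis
  proof unfold_locales
    show "f \<circ> j \<in> mon H ?G"
      using mon_compose[OF j_mon, of f ?G] iso by (simp add: iso_iff_mon_epi)
    show "(f \<circ> \<iota>) b1 = \<one>\<^bsub>?G\<^esub>" by (simp add: \<iota>_base)
    have "f ` carrier G \<subseteq> f ` generate G (\<iota> ` X)" using \<iota>_generates by blast
    also have "\<dots> = generate ?G (f ` \<iota> ` X)"
      using f.generate_img[of "\<iota> ` X"] \<iota>_closed by auto
    finally show "carrier ?G \<subseteq> generate ?G ((f \<circ> \<iota>) ` X)" by (simp add: C image_comp)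
  next
    fix m y assume m: "m \<in> compatible_medians H X act" "simplicial X m" and "y \<in> carrier ?G"
    then obtain y0 where y: "y = f y0" "y0 \<in> carrier G" by (auto simp: C)
    let ?S = "{z \<in> carrier G. \<forall>k\<in>carrier G. m (\<phi> k, \<phi> (k \<otimes> y0), \<phi> (k \<otimes> z)) = \<phi> (k \<otimes> z)}"
    have "{z \<in> carrier ?G. \<forall>k\<in>carrier ?G. m (?p k,
        ?p (k \<otimes>\<^bsub>?G\<^esub> y), ?p (k \<otimes>\<^bsub>?G\<^esub> z)) =
        ?p (k \<otimes>\<^bsub>?G\<^esub> z)} \<subseteq> f ` ?S"
      using y by (auto simp: C mul inv)
    then show "finite {z \<in> carrier ?G. \<forall>k\<in>carrier ?G. m (?p k,
        ?p (k \<otimes>\<^bsub>?G\<^esub> y), ?p (k \<otimes>\<^bsub>?G\<^esub> z)) =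
        ?p (k \<otimes>\<^bsub>?G\<^esub> z)}"
      using cells_finite[OF m y(2)] finite_surj by blast
  next
    fix m y z w assume m: "m \<in> compatible_medians H X act" "locally_linear X m"
      and r: "y \<in> carrier ?G" "z \<in> carrier ?G" "w \<in> carrier ?G"
      and zw: "\<forall>k\<in>carrier ?G. m (?p k,
          ?p (k \<otimes>\<^bsub>?G\<^esub> y), ?p (k \<otimes>\<^bsub>?G\<^esub> z)) =
          ?p (k \<otimes>\<^bsub>?G\<^esub> z)"
        "\<forall>k\<in>carrier ?G. m (?p k,
          ?p (k \<otimes>\<^bsub>?G\<^esub> y), ?p (k \<otimes>\<^bsub>?G\<^esub> w)) =
          ?p (k \<otimes>\<^bsub>?G\<^esub> w)"
    obtain y0 z0 w0 where 0: "y = f y0" "z = f z0" "w = f w0"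
      "y0 \<in> carrier G" "z0 \<in> carrier G" "w0 \<in> carrier G" using r by (auto simp: C)
    show "(\<forall>k\<in>carrier ?G. m (?p k,
          ?p (k \<otimes>\<^bsub>?G\<^esub> z), ?p (k \<otimes>\<^bsub>?G\<^esub> w)) =
          ?p (k \<otimes>\<^bsub>?G\<^esub> w)) \<or>
        (\<forall>k\<in>carrier ?G. m (?p k,
          ?p (k \<otimes>\<^bsub>?G\<^esub> w), ?p (k \<otimes>\<^bsub>?G\<^esub> z)) =
          ?p (k \<otimes>\<^bsub>?G\<^esub> z))"
      using cells_comparable[OF m 0(4-6)] zw 0 by (simp add: C mul inv)
  next
    fix k assume "k \<in> carrier ?G"
    then obtain k0 where k: "k = f k0" "k0 \<in> carrier G" by (auto simp: C)
    show "(\<exists>h\<in>carrier H. \<forall>u\<in>carrier ?G. ?p (k \<otimes>\<^bsub>?G\<^esub> u) =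
          act h (?p u)) \<or>
        (\<exists>c. \<forall>x\<in>X. ?p (k \<otimes>\<^bsub>?G\<^esub> (f \<circ> \<iota>) x) = c)"
      using shadow[OF k(2)] k by (simp add: C mul inv \<iota>_closed)
  next
    fix m y z w assume m: "m \<in> compatible_medians H X act"
      and r: "y \<in> carrier ?G" "z \<in> carrier ?G" "w \<in> carrier ?G"
    obtain y0 z0 w0 where 0: "y = f y0" "z = f z0" "w = f w0"
      "y0 \<in> carrier G" "z0 \<in> carrier G" "w0 \<in> carrier G" using r by (auto simp: C)
    show "\<exists>u\<in>carrier ?G. \<forall>k\<in>carrier ?G. ?p (k \<otimes>\<^bsub>?G\<^esub> u) =
        m (?p (k \<otimes>\<^bsub>?G\<^esub> y), ?p (k \<otimes>\<^bsub>?G\<^esub> z),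
          ?p (k \<otimes>\<^bsub>?G\<^esub> w))"
      using coords_median[OF m 0(4-6)] 0 by (simp add: C mul inv)
  next
    fix u v assume uv: "u \<in> carrier ?G" "v \<in> carrier ?G"
      "\<forall>k\<in>carrier ?G. ?p (k \<otimes>\<^bsub>?G\<^esub> u) =
        ?p (k \<otimes>\<^bsub>?G\<^esub> v)"
    obtain u0 v0 where 0: "u = f u0" "v = f v0" "u0 \<in> carrier G" "v0 \<in> carrier G"
      using uv(1,2) by (auto simp: C)
    show "u = v" using separation[OF 0(3,4)] uv(3) 0 by (simp add: C mul inv)
  qed (auto simp: C mul inv jC \<iota>_closed \<phi>_closed \<phi>_\<iota> \<iota>_act \<phi>_act)
qed

text \<open>The step \<open>(b, x)\<close> is spelled as \<open>b\<inverse> x\<close>, with \<open>False\<close> marking the inverted letter.\<close>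

fun spell :: "('x \<times> 'x) list \<Rightarrow> ('h, 'x) ambient" where
  "spell [] = []"
| "spell ((b, x) # w) = Inr (False, b) # Inr (True, x) # spell w"

lemma inj_spell: "inj spell"
proof (rule injI)
  show "u = v" if "spell u = (spell v :: ('h, 'x) ambient)" for u v :: "('x \<times> 'x) list"
    using that
  proof (induction u arbitrary: v)
    case Nil
    then show ?case by (cases v rule: spell.cases) auto
  next
    case (Cons s u)
    then show ?case by (cases s; cases v rule: spell.cases) auto
  qed
qed

theorem theorem1:
  fixes H :: "'h monoid" and X :: "'x set" and act :: "'h \<Rightarrow> 'x \<Rightarrow> 'x" and b1 :: 'x
  assumes "group H" and "free_action H X act" and "b1 \<in> X"
  shows "\<exists>(Hh :: ('h, 'x) ambient monoid) (j :: 'h \<Rightarrow> ('h, 'x) ambient)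
            (\<iota> :: 'x \<Rightarrow> ('h, 'x) ambient) (\<phi> :: ('h, 'x) ambient \<Rightarrow> 'x).
      group Hh \<and> j \<in> mon H Hh \<and>
      \<iota> \<in> X \<rightarrow> carrier Hh \<and> inj_on \<iota> X \<and>
      \<phi> \<in> carrier Hh \<rightarrow> X \<and> (\<forall>x\<in>X. \<phi> (\<iota> x) = x) \<and>
      (\<forall>h\<in>carrier H. \<forall>x\<in>X. \<iota> (act h x) = j h \<otimes>\<^bsub>Hh\<^esub> \<iota> x) \<and>
      (\<forall>h\<in>carrier H. \<forall>u\<in>carrier Hh. \<phi> (j h \<otimes>\<^bsub>Hh\<^esub> u) = act h (\<phi> u)) \<and>
      \<iota> b1 = \<one>\<^bsub>Hh\<^esub> \<and> \<iota> ` orbit H act b1 = j ` carrier H \<and>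
      generate Hh (\<iota> ` X) = carrier Hh \<and>
      (\<forall>m\<in>compatible_medians H X act.
         (\<exists>!mh. median_extension Hh X \<iota> \<phi> m mh) \<and>
         (\<forall>mh. median_extension Hh X \<iota> \<phi> m mh \<longrightarrow>
            (locally_linear X m \<longrightarrow> locally_linear (carrier Hh) mh) \<and>
            (simplicial X m \<longrightarrow> simplicial (carrier Hh) mh)))"
proof -
  interpret pointed_free_action H X act b1
    using assms by (simp add: pointed_free_action_def)
  interpret W: coordinate_group H X act b1 words act_word embed fold_base
    by (rule words_coordinate_group)
  define f :: "('x \<times> 'x) list \<Rightarrow> ('h, 'x) ambient" where "f = spell"
  have "inj_on f (carrier words)" unfolding f_def using inj_spell inj_on_subset by blast
  then obtain Hh :: "('h, 'x) ambient monoid" and j \<iota> \<phi>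
    where "coordinate_group H X act b1 Hh j \<iota> \<phi>"
    using W.coordinate_group_image by blast
  then interpret E: coordinate_group H X act b1 Hh j \<iota> \<phi> .
  show ?thesis
  proof (intro exI conjI ballI allI impI)
    show "group Hh" by (rule E.is_group)
    show "j \<in> mon H Hh" by (rule E.j_mon)
    show "\<iota> \<in> X \<rightarrow> carrier Hh" "\<phi> \<in> carrier Hh \<rightarrow> X" using E.\<iota>_closed E.\<phi>_closed by auto
    show "inj_on \<iota> X" using E.\<phi>_\<iota> by (rule inj_on_inverseI)
    show "\<iota> b1 = \<one>\<^bsub>Hh\<^esub>" by (rule E.\<iota>_base)
    show "\<iota> ` orbit H act b1 = j ` carrier H" by (rule E.orbit_of_base)
    show "generate Hh (\<iota> ` X) = carrier Hh"
      using E.\<iota>_generates E.generate_incl[of "\<iota> ` X"] E.\<iota>_closed by auto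
  next
    fix m assume "m \<in> compatible_medians H X act"
    then show "\<exists>!mh. median_extension Hh X \<iota> \<phi> m mh" by (rule E.median_extension_unique_exists)
  next
    fix m mh assume m: "m \<in> compatible_medians H X act" and mh: "median_extension Hh X \<iota> \<phi> m mh"
    note c = E.extension_coordinatewise[OF this]
    show "locally_linear (carrier Hh) mh" if "locally_linear X m"
      using E.coordinatewise_locally_linear[OF m c that] .
    show "simplicial (carrier Hh) mh" if "simplicial X m"
      using E.coordinatewise_simplicial[OF m c that] .
  qed (simp_all add: E.\<phi>_\<iota> E.\<iota>_act E.\<phi>_act)
qed

end
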